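(* Let $P$ be a threaded program and suppose the ESST procedure run on $P$ terminates. Then: (1) If it returns a feasible counter-example path $\hat\rho$, then there are an initial configuration $\gamma$ and an error configuration $\gamma'$ of $P$ with $\gamma\rightsquigarrow_{\hat\rho}\gamma'$. (2) If it returns a safe ARF $\mathcal F$, then for every configuration $\gamma$ reachable in $P$ there is a node $\eta$ of $\mathcal F$ with $\gamma\models\eta$.
   Context: Operations. Program variables are integer valued. An operation is either an assignment $x:=e$, where $e$ is a variable, an integer constant, the nondeterministic construct $*$, an arithmetic combination of such expressions, or (only as the entire right-hand side) a call $f(e_1,\dots,e_n)$ to a primitive function; or an assumption $[b]$ with $b$ a Boolean expression. A control-flow graph (CFG) is $(L,E,l_0,L_{err})$: locations $L$, edges $E\subseteq L\times Ops\times L$ labelled by operations, entry $l_0$ with no incoming edges, error locations $L_{err}\subseteq L$ with no outgoing edges. Threaded programs. A threaded program $P$ consists of threads $T_1,\dots,T_N$, one designated $main$. Each $T_i$ has a CFG $G_{T_i}=(L_i,E_i,l_0^i,L^i_{err})$ and local variables $LVar(T_i)$; these sets are pairwise disjoint and disjoint from the global variables $GVar$; operations of $T_i$ mention only $LVar(T_i)\cup GVar$. A state over a variable set $V$ is a map $V\to\mathbb Z$; for disjoint domains $s_1\cup s_2$ is their union. A scheduler state $\mathbb S$ is a valuation of a set $SVar$ of scheduler variables, containing for each thread $T$ a variable $st_T\in\{Running,Runnable,Waiting\}$, with at most one thread Running. Each $n$-ary primitive function $f$ has an associated $f'$ mapping $n$ integers and a scheduler state to a pair (integer, scheduler state). A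 scheduler is a function $Sched$ mapping each scheduler state with no running thread to a set of scheduler states with exactly one running thread. Arguments of primitive function calls are assumed to be integer constants. There is a fixed initial scheduler state $\mathbb S_0$ in which $main$ is Running and no other thread is. Semantics. Expressions are evaluated in a local state $s$, global state $gs$, scheduler state $\mathbb S$: variables read from $s$ or $gs$, constants are themselves, $*$ yields any integer, arithmetic is applied to subexpression values, all leaving $\mathbb S$ unchanged; $f(e_1,\dots,e_n)$ yields $f'(v_1,\dots,v_n,\mathbb S)$ where $v_k$ is the value of $e_k$. A configuration is $\gamma=\langle (l_1,s_1),\dots,(l_N,s_N),gs,\mathbb S\rangle$ with $l_i\in L_i$, $s_i$ a state over $LVar(T_i)$, $gs$ over $GVar$. If $\mathbb S(st_{T_i})=Running$ and $(l_i,op,l_i')\in E_i$: for $op=[b]$ with $b$ true, $\gamma\xrightarrow{op}\gamma'$ where $\gamma'$ replaces $l_i$ by $l_i'$; for $op= x:=e$ and any evaluation $(v,\mathbb S')$ of $e$, $\gamma\xrightarrow{op}\gamma'$ where $\gamma'$ replaces $l_i$ by $l_i'$, sets $x$ to $v$ (in $s_i$ or $gs$) and replaces $\mathbb S$ by $\mathbb S'$. If no thread is Running in $\mathbb S$, then $\gamma\xrightarrow{\cdot}\gamma'$ for every $\gamma'$ obtained by replacing $\mathbb S$ with some $\mathbb S'\in Sched(\mathbb S)$. A configuration is initial if every $l_i=l_0^i$ and its scheduler state is $\mathbb S_0$; it is an error configuration if some $l_i\in L^i_{err}$; it is reachable if it is reached from an initial configuration by a finite sequence of such transitions. Symbolic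 notions. $s\models\varphi$ means formula $\varphi$ holds in $s$. Strongest post-conditions: $SP_{x:=e}(\varphi)=\exists x'.\varphi[x'/x]\wedge x=e[x'/x]$ ($e\neq *$), $SP_{x:=*}(\varphi)=\exists x'.\varphi[x'/x]\wedge x=a$ ($a$ fresh), $SP_{[b]}(\varphi)=\varphi\wedge b$, and for a sequence $op_1,\dots,op_n$ the composition $SP_{op_n}(\cdots SP_{op_1}(\varphi)\cdots)$. A precision $\pi$ is a finite set of predicates; $SP^\pi_{op}(\varphi)$ is the strongest Boolean combination of predicates of $\pi$ implied by $SP_{op}(\varphi)$. ARF. An ARF node is $\eta=(\langle l_1,\varphi_1\rangle,\dots,\langle l_N,\varphi_N\rangle,\varphi,\mathbb S)$ with $l_i\in L_i$, $\varphi_i$ a formula over $LVar(T_i)\cup GVar$, $\varphi$ a formula over all variables, $\mathbb S$ a scheduler state. Precisions $\pi_l$ are attached to locations and $\pi$ to the global region. Rule (E1): if $T_i$ is Running in $\mathbb S$ and $(l_i,op,l_i')\in E_i$, let $\hat{op}=op$, $\mathbb S'=\mathbb S$ if $op$ has no primitive call, and if $op$ is $x:=f(\vec y)$ let $(v,\mathbb S')=f'(\vec y,\mathbb S)$ and $\hat{op}$ be $x:=v$; the successor has location $l_i'$ for $T_i$, $\varphi_i'=SP^{\pi_{l_i'}}_{\hat{op}}(\varphi_i\wedge\varphi)$, for $j\neq i$ $\varphi_j'=SP^{\pi_{l_j}}_{havoc(\hat{op})}(\varphi_j\wedge\varphi)$ if $\hat{op}$ possibly updates global variables (else $\varphi_j'=\varphi_j$),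 $\varphi'=SP^\pi_{\hat{op}}(\varphi)$, scheduler state $\mathbb S'$; $havoc(\hat{op})$ assigns fresh variables to the global variables possibly updated by $\hat{op}$. The resulting ART edge is labelled $\hat{op}$ and arises from CFG operation $op$. Rule (E2): if no thread is Running in $\mathbb S$, for each $\mathbb S'\in Sched(\mathbb S)$ the node with the same locations and regions and scheduler state $\mathbb S'$ is a successor; this edge is an ARF connector. The initial node has all $l_i=l_0^i$, all $\varphi_i$ and $\varphi$ equal to $true$, and scheduler state $\mathbb S_0$. A node $\eta$ is covered by $(\langle l'_1,\varphi'_1\rangle,\dots,\langle l'_N,\varphi'_N\rangle,\varphi',\mathbb S')$ if $l_i=l_i'$ for all $i$, $\mathbb S=\mathbb S'$, and $\varphi\Rightarrow\varphi'$ and $\bigwedge_i(\varphi_i\Rightarrow\varphi_i')$ are valid. An ARF (a graph of such nodes, ART edges and connectors grown from the initial node) is complete if it is closed under (E1)/(E2) for every node that is not covered by another node and whose formula $\varphi\wedge\bigwedge_i\varphi_i$ is satisfiable. A node is an error node if $\varphi\wedge\bigwedge_i\varphi_i$ is satisfiable and some $l_i$ is an error location. An ARF is safe if it is complete and contains no error node. Paths. An ARF path is a sequence $\xi_1,\dots,\xi_m$ of ART edges and ARF connectors, the target of each being the source of the next. A counter-example path is an ARF path from the initial node to an error node; it is feasible if $SP_{\sigma}(true)$ is satisfiable, where $\sigma$ is the sequence of labels $\hat{op}$ of its ART edges in order (connectors omitted). A configuration satisfies a node, $\gamma\models\eta$, iff the locations agree, $s_i\cup gs\models\varphi_i$ for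 all $i$, $s_1\cup\dots\cup s_N\cup gs\models\varphi$, and the scheduler states are equal. For an ART edge $\varepsilon$ from $\eta$ to $\eta'$ arising from CFG operation $op$, $\gamma\rightsquigarrow_\varepsilon\gamma'$ means $\gamma\models\eta$, $\gamma'\models\eta'$ and $\gamma\xrightarrow{op}\gamma'$; for a connector $\kappa$ from $\eta$ to $\eta'$, $\gamma\rightsquigarrow_\kappa\gamma'$ means $\gamma\models\eta$, $\gamma'\models\eta'$ and $\gamma\xrightarrow{\cdot}\gamma'$. For an ARF path $\hat\rho=\xi_1,\dots,\xi_m$, $\gamma\rightsquigarrow_{\hat\rho}\gamma'$ means there are configurations $\gamma_1=\gamma,\gamma_2,\dots,\gamma_{m+1}=\gamma'$ with $\gamma_k\rightsquigarrow_{\xi_k}\gamma_{k+1}$ for all $k$. ESST procedure. Starting from the ARF consisting of the initial node, ESST repeatedly expands nodes that are not covered by another node and whose formula $\varphi\wedge\bigwedge_i\varphi_i$ is satisfiable, using (E1)/(E2) with the current precisions. When an error node is reached it checks the counter-example path to it: if feasible, it returns this path; otherwise it adds predicates to the precisions, removes part of the ARF containing the path and continues. If the ARF becomes safe, it returns it. *)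

theory Defs
  imports Main
begin

section \<open>Threaded programs\<close>

text \<open>
  The binary arithmetic and relational symbols are represented by the total functions they
  denote.  Calls of primitive functions occur only as the entire right-hand side of an
  assignment, hence they are a separate form of operation, and basic operations are call-free.
\<close>

datatype (exp_vars: 'v) exp =
    Var 'v
  | Const int
  | Nondet
  | Arith "int \<Rightarrow> int \<Rightarrow> int" "'v exp" "'v exp"

datatype (bexp_vars: 'v) bexp =
    BConst bool
  | Rel "int \<Rightarrow> int \<Rightarrow> bool" "'v exp" "'v exp"
  | BNot "'v bexp"
  | BAnd "'v bexp" "'v bexp"
  | BOr "'v bexp" "'v bexp"

datatype (basic_vars: 'v) basic_op =
    Assign 'v "'v exp"
  | Assume "'v bexp"

datatype (op_vars: 'v, op_prims: 'f) op =
    Basic "'v basic_op"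
  | AssignCall 'v 'f "'v exp list"

text \<open>
  The scheduler variables are \<open>st\<^sub>T\<close> for every thread \<open>T\<close> (field \<open>status\<close>), and further variables
  \<open>'x\<close> with values in \<open>'d\<close> (field \<open>svars\<close>).
\<close>

datatype thread_status = Running | Runnable | Waiting

record ('t, 'x, 'd) sched_state =
  status :: "'t \<Rightarrow> thread_status"
  svars :: "'x \<Rightarrow> 'd"

definition no_running :: "('t, 'x, 'd) sched_state \<Rightarrow> bool" where
  "no_running S \<longleftrightarrow> (\<forall>t. status S t \<noteq> Running)"

definition sched_state_ok :: "('t, 'x, 'd) sched_state \<Rightarrow> bool" where
  "sched_state_ok S \<longleftrightarrow> (\<forall>t u. status S t = Running \<and> status S u = Running \<longrightarrow> t = u)"

record ('l, 'v, 'f) cfg =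
  locs :: "'l set"
  cfg_edges :: "('l \<times> ('v, 'f) op \<times> 'l) set"
  entry :: 'l
  err_locs :: "'l set"

text \<open>The threads of a program are the elements of the type \<open>'t\<close>, which is finite in the theorem.\<close>

record ('t, 'l, 'v, 'f, 'x, 'd) program =
  cfg :: "'t \<Rightarrow> ('l, 'v, 'f) cfg"
  main :: 't
  lvars :: "'t \<Rightarrow> 'v set"
  gvars :: "'v set"
  arity :: "'f \<Rightarrow> nat"
  prim :: "'f \<Rightarrow> int list \<Rightarrow> ('t, 'x, 'd) sched_state \<Rightarrow> int \<times> ('t, 'x, 'd) sched_state"
  sched :: "('t, 'x, 'd) sched_state \<Rightarrow> ('t, 'x, 'd) sched_state set"
  init_sched :: "('t, 'x, 'd) sched_state"

definition cfg_ok :: "('l, 'v, 'f) cfg \<Rightarrow> bool" where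
  "cfg_ok G \<longleftrightarrow>
     cfg_edges G \<subseteq> locs G \<times> UNIV \<times> locs G \<and>
     entry G \<in> locs G \<and> (\<forall>l op. (l, op, entry G) \<notin> cfg_edges G) \<and>
     err_locs G \<subseteq> locs G \<and> (\<forall>l op l'. l \<in> err_locs G \<longrightarrow> (l, op, l') \<notin> cfg_edges G)"

fun call_ok :: "('f \<Rightarrow> nat) \<Rightarrow> ('v, 'f) op \<Rightarrow> bool" where
  "call_ok ar (Basic b) \<longleftrightarrow> True"
| "call_ok ar (AssignCall x f es) \<longleftrightarrow>
     length es = ar f \<and> (\<forall>e \<in> set es. \<exists>c. e = Const c)"

definition threaded_program :: "('t, 'l, 'v, 'f, 'x, 'd) program \<Rightarrow> bool" where
  "threaded_program P \<longleftrightarrow>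
     (\<forall>t. cfg_ok (cfg P t)) \<and>
     (\<forall>t u. t \<noteq> u \<longrightarrow> lvars P t \<inter> lvars P u = {}) \<and>
     (\<forall>t. lvars P t \<inter> gvars P = {}) \<and>
     (\<forall>t l op l'. (l, op, l') \<in> cfg_edges (cfg P t) \<longrightarrow>
        op_vars op \<subseteq> lvars P t \<union> gvars P \<and> call_ok (arity P) op) \<and>
     (\<forall>f vs S. length vs = arity P f \<and> sched_state_ok S \<longrightarrow>
        sched_state_ok (snd (prim P f vs S))) \<and>
     (\<forall>S. sched_state_ok S \<and> no_running S \<longrightarrow>
        (\<forall>S' \<in> sched P S. \<exists>!t. status S' t = Running)) \<and>
     (\<forall>t. status (init_sched P) t = Running \<longleftrightarrow> t = main P)"

section \<open>Semantics\<close>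

text \<open>
  The set of values of an expression; every occurrence of \<open>Nondet\<close> is resolved independently.
  A Boolean expression is true for some resolution iff \<open>True\<close> is among its values.
\<close>

primrec vals :: "'v exp \<Rightarrow> ('v \<Rightarrow> int) \<Rightarrow> int set" where
  "vals (Var x) \<sigma> = {\<sigma> x}"
| "vals (Const c) \<sigma> = {c}"
| "vals Nondet \<sigma> = UNIV"
| "vals (Arith f e1 e2) \<sigma> = {f v1 v2 | v1 v2. v1 \<in> vals e1 \<sigma> \<and> v2 \<in> vals e2 \<sigma>}"

primrec bvals :: "'v bexp \<Rightarrow> ('v \<Rightarrow> int) \<Rightarrow> bool set" where
  "bvals (BConst p) \<sigma> = {p}"
| "bvals (Rel r e1 e2) \<sigma> = {r v1 v2 | v1 v2. v1 \<in> vals e1 \<sigma> \<and> v2 \<in> vals e2 \<sigma>}"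
| "bvals (BNot b) \<sigma> = {\<not> p | p. p \<in> bvals b \<sigma>}"
| "bvals (BAnd b1 b2) \<sigma> = {p \<and> q | p q. p \<in> bvals b1 \<sigma> \<and> q \<in> bvals b2 \<sigma>}"
| "bvals (BOr b1 b2) \<sigma> = {p \<or> q | p q. p \<in> bvals b1 \<sigma> \<and> q \<in> bvals b2 \<sigma>}"

text \<open>
  A state over \<open>V\<close> is a partial map with domain \<open>V\<close>.  Only the values of \<open>valuation s\<close> on the
  domain of \<open>s\<close> are ever relevant.
\<close>

definition valuation :: "('v \<rightharpoonup> int) \<Rightarrow> 'v \<Rightarrow> int" where
  "valuation s = (\<lambda>x. the (s x))"

record ('t, 'l, 'v, 'x, 'd) config =
  cloc :: "'t \<Rightarrow> 'l"
  clocal :: "'t \<Rightarrow> ('v \<rightharpoonup> int)"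
  cglobal :: "'v \<rightharpoonup> int"
  csched :: "('t, 'x, 'd) sched_state"

definition is_config ::
  "('t, 'l, 'v, 'f, 'x, 'd) program \<Rightarrow> ('t, 'l, 'v, 'x, 'd) config \<Rightarrow> bool" where
  "is_config P \<gamma> \<longleftrightarrow>
     (\<forall>t. cloc \<gamma> t \<in> locs (cfg P t)) \<and>
     (\<forall>t. dom (clocal \<gamma> t) = lvars P t) \<and> dom (cglobal \<gamma>) = gvars P \<and>
     sched_state_ok (csched \<gamma>)"

definition thread_state :: "('t, 'l, 'v, 'x, 'd) config \<Rightarrow> 't \<Rightarrow> ('v \<rightharpoonup> int)" where
  "thread_state \<gamma> t = clocal \<gamma> t ++ cglobal \<gamma>"

text \<open>Union of a family of maps with pairwise disjoint domains.\<close>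

definition map_Union :: "('a \<rightharpoonup> 'b) set \<Rightarrow> ('a \<rightharpoonup> 'b)" where
  "map_Union M = (\<lambda>x. if \<exists>m \<in> M. x \<in> dom m then Some (THE v. \<exists>m \<in> M. m x = Some v) else None)"

definition joint_state :: "('t, 'l, 'v, 'x, 'd) config \<Rightarrow> ('v \<rightharpoonup> int)" where
  "joint_state \<gamma> = map_Union (insert (cglobal \<gamma>) (range (clocal \<gamma>)))"

definition move :: "'t \<Rightarrow> 'l \<Rightarrow> ('t, 'l, 'v, 'x, 'd) config \<Rightarrow> ('t, 'l, 'v, 'x, 'd) config" where
  "move t l' \<gamma> = \<gamma>\<lparr>cloc := (cloc \<gamma>)(t := l')\<rparr>"

definition store :: "('t, 'l, 'v, 'f, 'x, 'd) program \<Rightarrow> 't \<Rightarrow> 'v \<Rightarrow> int \<Rightarrow>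
    ('t, 'l, 'v, 'x, 'd) config \<Rightarrow> ('t, 'l, 'v, 'x, 'd) config" where
  "store P t x v \<gamma> =
     (if x \<in> gvars P then \<gamma>\<lparr>cglobal := (cglobal \<gamma>)(x \<mapsto> v)\<rparr>
      else \<gamma>\<lparr>clocal := (clocal \<gamma>)(t := (clocal \<gamma> t)(x \<mapsto> v))\<rparr>)"

text \<open>
  Transitions are labelled by \<open>Some op\<close> if a thread executes \<open>op\<close>, and by \<open>None\<close> if the scheduler
  is executed.
\<close>

inductive config_step :: "('t, 'l, 'v, 'f, 'x, 'd) program \<Rightarrow>
    ('t, 'l, 'v, 'x, 'd) config \<Rightarrow> ('v, 'f) op option \<Rightarrow> ('t, 'l, 'v, 'x, 'd) config \<Rightarrow> bool"
  for P where
  step_assume: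
    "\<lbrakk>is_config P \<gamma>; status (csched \<gamma>) t = Running;
      (cloc \<gamma> t, Basic (Assume b), l') \<in> cfg_edges (cfg P t);
      True \<in> bvals b (valuation (thread_state \<gamma> t))\<rbrakk>
     \<Longrightarrow> config_step P \<gamma> (Some (Basic (Assume b))) (move t l' \<gamma>)"
| step_assign:
    "\<lbrakk>is_config P \<gamma>; status (csched \<gamma>) t = Running;
      (cloc \<gamma> t, Basic (Assign x e), l') \<in> cfg_edges (cfg P t);
      v \<in> vals e (valuation (thread_state \<gamma> t))\<rbrakk>
     \<Longrightarrow> config_step P \<gamma> (Some (Basic (Assign x e))) (store P t x v (move t l' \<gamma>))"
| step_call:
    "\<lbrakk>is_config P \<gamma>; status (csched \<gamma>) t = Running;
      (cloc \<gamma> t, AssignCall x f es, l') \<in> cfg_edges (cfg P t);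
      list_all2 (\<lambda>e v. v \<in> vals e (valuation (thread_state \<gamma> t))) es vs;
      prim P f vs (csched \<gamma>) = (v, S')\<rbrakk>
     \<Longrightarrow> config_step P \<gamma> (Some (AssignCall x f es)) ((store P t x v (move t l' \<gamma>))\<lparr>csched := S'\<rparr>)"
| step_sched:
    "\<lbrakk>is_config P \<gamma>; no_running (csched \<gamma>); S' \<in> sched P (csched \<gamma>)\<rbrakk>
     \<Longrightarrow> config_step P \<gamma> None (\<gamma>\<lparr>csched := S'\<rparr>)"

definition initial_config ::
  "('t, 'l, 'v, 'f, 'x, 'd) program \<Rightarrow> ('t, 'l, 'v, 'x, 'd) config \<Rightarrow> bool" where
  "initial_config P \<gamma> \<longleftrightarrow>
     is_config P \<gamma> \<and> (\<forall>t. cloc \<gamma> t = entry (cfg P t)) \<and> csched \<gamma> = init_sched P"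

definition error_config ::
  "('t, 'l, 'v, 'f, 'x, 'd) program \<Rightarrow> ('t, 'l, 'v, 'x, 'd) config \<Rightarrow> bool" where
  "error_config P \<gamma> \<longleftrightarrow> is_config P \<gamma> \<and> (\<exists>t. cloc \<gamma> t \<in> err_locs (cfg P t))"

inductive reachable ::
  "('t, 'l, 'v, 'f, 'x, 'd) program \<Rightarrow> ('t, 'l, 'v, 'x, 'd) config \<Rightarrow> bool"
  for P where
  reachable_init: "initial_config P \<gamma> \<Longrightarrow> reachable P \<gamma>"
| reachable_step: "\<lbrakk>reachable P \<gamma>; config_step P \<gamma> a \<gamma>'\<rbrakk> \<Longrightarrow> reachable P \<gamma>'"

section \<open>Formulas, strongest post-conditions, and predicate abstraction\<close>

text \<open>
  Formulas are identified with the predicates on valuations that they denote.  In particular,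
  equivalent formulas are equal, and \<open>\<phi> \<le> \<psi>\<close> states that the implication from \<open>\<phi>\<close> to \<open>\<psi>\<close> is
  valid.  The substitution of the value \<open>c\<close> for \<open>x\<close> in \<open>\<phi>\<close> is \<open>\<lambda>\<sigma>. \<phi> (\<sigma>(x := c))\<close>.
\<close>

type_synonym 'v fml = "('v \<Rightarrow> int) \<Rightarrow> bool"

definition fml_over :: "'v set \<Rightarrow> 'v fml \<Rightarrow> bool" where
  "fml_over V \<phi> \<longleftrightarrow> (\<forall>\<sigma> \<tau>. (\<forall>x \<in> V. \<sigma> x = \<tau> x) \<longrightarrow> \<phi> \<sigma> = \<phi> \<tau>)"

definition holds :: "('v \<rightharpoonup> int) \<Rightarrow> 'v fml \<Rightarrow> bool" (infix "\<Turnstile>" 50) where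
  "s \<Turnstile> \<phi> \<longleftrightarrow> \<phi> (valuation s)"

definition satisfiable :: "'v fml \<Rightarrow> bool" where
  "satisfiable \<phi> \<longleftrightarrow> (\<exists>\<sigma>. \<phi> \<sigma>)"

definition fml_conj :: "'v fml \<Rightarrow> 'v fml \<Rightarrow> 'v fml" where
  "fml_conj \<phi> \<psi> = (\<lambda>\<sigma>. \<phi> \<sigma> \<and> \<psi> \<sigma>)"

text \<open>
  Every occurrence of \<open>Nondet\<close> stands for a fresh variable.  Fresh variables are not program
  variables, and membership in \<open>vals\<close> and \<open>bvals\<close> quantifies their values existentially.
  This affects neither satisfiability nor the implied formulas over program variables.
  For a deterministic \<open>e\<close>, the second conjunct is the equation of \<open>x\<close> and \<open>e[x'/x]\<close>.
\<close>

fun SP :: "'v basic_op \<Rightarrow> 'v fml \<Rightarrow> 'v fml" where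
  "SP (Assign x e) \<phi> = (\<lambda>\<sigma>. \<exists>x'. \<phi> (\<sigma>(x := x')) \<and> \<sigma> x \<in> vals e (\<sigma>(x := x')))"
| "SP (Assume b) \<phi> = (\<lambda>\<sigma>. \<phi> \<sigma> \<and> True \<in> bvals b \<sigma>)"

definition SP_seq :: "'v basic_op list \<Rightarrow> 'v fml \<Rightarrow> 'v fml" where
  "SP_seq ops = fold SP ops"

inductive_set bool_combs :: "'v fml set \<Rightarrow> 'v fml set" for \<pi> where
  bc_pred: "p \<in> \<pi> \<Longrightarrow> p \<in> bool_combs \<pi>"
| bc_true: "(\<lambda>_. True) \<in> bool_combs \<pi>"
| bc_not: "\<phi> \<in> bool_combs \<pi> \<Longrightarrow> (\<lambda>\<sigma>. \<not> \<phi> \<sigma>) \<in> bool_combs \<pi>"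
| bc_and: "\<lbrakk>\<phi> \<in> bool_combs \<pi>; \<psi> \<in> bool_combs \<pi>\<rbrakk> \<Longrightarrow> (\<lambda>\<sigma>. \<phi> \<sigma> \<and> \<psi> \<sigma>) \<in> bool_combs \<pi>"
| bc_or: "\<lbrakk>\<phi> \<in> bool_combs \<pi>; \<psi> \<in> bool_combs \<pi>\<rbrakk> \<Longrightarrow> (\<lambda>\<sigma>. \<phi> \<sigma> \<or> \<psi> \<sigma>) \<in> bool_combs \<pi>"

text \<open>The strongest Boolean combination exists because precisions are finite.\<close>

definition SP_abs :: "'v fml set \<Rightarrow> 'v basic_op \<Rightarrow> 'v fml \<Rightarrow> 'v fml" where
  "SP_abs \<pi> b \<phi> = (LEAST \<psi>. \<psi> \<in> bool_combs \<pi> \<and> SP b \<phi> \<le> \<psi>)"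

section \<open>Abstract reachability forests\<close>

record ('t, 'l, 'v, 'x, 'd) node =
  nloc :: "'t \<Rightarrow> 'l"
  nregion :: "'t \<Rightarrow> 'v fml"
  nglobal :: "'v fml"
  nsched :: "('t, 'x, 'd) sched_state"

text \<open>
  The nodes of a forest are these tuples themselves, so two nodes with the same data are one node.
  Together with the identification of equivalent formulas, this makes \<open>covered_by\<close> below a partial
  order: distinct nodes cannot cover each other and thereby both stay unexpanded.
\<close>

definition node_fml :: "('t, 'l, 'v, 'x, 'd) node \<Rightarrow> 'v fml" where
  "node_fml \<eta> = (\<lambda>\<sigma>. nglobal \<eta> \<sigma> \<and> (\<forall>t. nregion \<eta> t \<sigma>))"

text \<open>
  The precisions of locations are also indexed by threads, because the location sets of the
  threads are not assumed to be disjoint.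
\<close>

record ('t, 'l, 'v) precision =
  ploc :: "'t \<Rightarrow> 'l \<Rightarrow> 'v fml set"
  pglobal :: "'v fml set"

definition precision_ok ::
  "('t, 'l, 'v, 'f, 'x, 'd) program \<Rightarrow> ('t, 'l, 'v) precision \<Rightarrow> bool" where
  "precision_ok P \<pi> \<longleftrightarrow>
     (\<forall>t l. finite (ploc \<pi> t l) \<and> (\<forall>p \<in> ploc \<pi> t l. fml_over (lvars P t \<union> gvars P) p)) \<and>
     finite (pglobal \<pi>) \<and> (\<forall>p \<in> pglobal \<pi>. fml_over ((\<Union>t. lvars P t) \<union> gvars P) p)"

text \<open>
  \<open>concretize P S op b S'\<close>: executing \<open>op\<close> in the scheduler state \<open>S\<close> amounts to the call-free
  operation \<open>b\<close> and leads to the scheduler state \<open>S'\<close>.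
\<close>

inductive concretize :: "('t, 'l, 'v, 'f, 'x, 'd) program \<Rightarrow> ('t, 'x, 'd) sched_state \<Rightarrow>
    ('v, 'f) op \<Rightarrow> 'v basic_op \<Rightarrow> ('t, 'x, 'd) sched_state \<Rightarrow> bool"
  for P S where
  conc_basic: "concretize P S (Basic b) b S"
| conc_call: "prim P f cs S = (v, S') \<Longrightarrow>
    concretize P S (AssignCall x f (map Const cs)) (Assign x (Const v)) S'"

fun updates_global :: "'v set \<Rightarrow> 'v basic_op \<Rightarrow> bool" where
  "updates_global V (Assign x e) \<longleftrightarrow> x \<in> V"
| "updates_global V (Assume b) \<longleftrightarrow> False"

text \<open>Only applied to operations that update a global variable.\<close>

fun havoc :: "'v basic_op \<Rightarrow> 'v basic_op" where
  "havoc (Assign x e) = Assign x Nondet"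
| "havoc (Assume b) = Assume (BConst True)"

text \<open>The abstract successor of \<open>\<eta>\<close> if thread \<open>t\<close> executes the call-free operation \<open>b\<close> and moves to \<open>l'\<close>.\<close>

definition succ_node :: "('t, 'l, 'v, 'f, 'x, 'd) program \<Rightarrow> ('t, 'l, 'v) precision \<Rightarrow>
    ('t, 'l, 'v, 'x, 'd) node \<Rightarrow> 't \<Rightarrow> 'l \<Rightarrow> 'v basic_op \<Rightarrow> ('t, 'x, 'd) sched_state \<Rightarrow>
    ('t, 'l, 'v, 'x, 'd) node" where
  "succ_node P \<pi> \<eta> t l' b S' =
     \<lparr>nloc = (nloc \<eta>)(t := l'),
      nregion = (\<lambda>j.
        if j = t then SP_abs (ploc \<pi> t l') b (fml_conj (nregion \<eta> t) (nglobal \<eta>))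
        else if updates_global (gvars P) b
        then SP_abs (ploc \<pi> j (nloc \<eta> j)) (havoc b) (fml_conj (nregion \<eta> j) (nglobal \<eta>))
        else nregion \<eta> j),
      nglobal = SP_abs (pglobal \<pi>) b (nglobal \<eta>),
      nsched = S'\<rparr>"

text \<open>
  An ART edge consists of its source, the CFG operation it arises from, its (call-free) label,
  and its target.
\<close>

datatype ('t, 'l, 'v, 'f, 'x, 'd) arf_edge =
    ART (src: "('t, 'l, 'v, 'x, 'd) node") "('v, 'f) op" "'v basic_op"
      (tgt: "('t, 'l, 'v, 'x, 'd) node")
  | Connector (src: "('t, 'l, 'v, 'x, 'd) node") (tgt: "('t, 'l, 'v, 'x, 'd) node")

record ('t, 'l, 'v, 'f, 'x, 'd) arf =
  nodes :: "('t, 'l, 'v, 'x, 'd) node set"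
  arf_edges :: "('t, 'l, 'v, 'f, 'x, 'd) arf_edge set"

inductive_set expansions :: "('t, 'l, 'v, 'f, 'x, 'd) program \<Rightarrow> ('t, 'l, 'v) precision \<Rightarrow>
    ('t, 'l, 'v, 'x, 'd) node \<Rightarrow> ('t, 'l, 'v, 'f, 'x, 'd) arf_edge set"
  for P \<pi> \<eta> where
  expand_op: "\<lbrakk>status (nsched \<eta>) t = Running; (nloc \<eta> t, op, l') \<in> cfg_edges (cfg P t);
        concretize P (nsched \<eta>) op b S'\<rbrakk>
       \<Longrightarrow> ART \<eta> op b (succ_node P \<pi> \<eta> t l' b S') \<in> expansions P \<pi> \<eta>"
| expand_sched: "\<lbrakk>no_running (nsched \<eta>); S' \<in> sched P (nsched \<eta>)\<rbrakk>
       \<Longrightarrow> Connector \<eta> (\<eta>\<lparr>nsched := S'\<rparr>) \<in> expansions P \<pi> \<eta>"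

definition initial_node ::
  "('t, 'l, 'v, 'f, 'x, 'd) program \<Rightarrow> ('t, 'l, 'v, 'x, 'd) node" where
  "initial_node P = \<lparr>nloc = (\<lambda>t. entry (cfg P t)), nregion = (\<lambda>_ _. True),
     nglobal = (\<lambda>_. True), nsched = init_sched P\<rparr>"

definition covered_by ::
  "('t, 'l, 'v, 'x, 'd) node \<Rightarrow> ('t, 'l, 'v, 'x, 'd) node \<Rightarrow> bool" where
  "covered_by \<eta> \<eta>' \<longleftrightarrow> nloc \<eta> = nloc \<eta>' \<and> nsched \<eta> = nsched \<eta>' \<and>
     nglobal \<eta> \<le> nglobal \<eta>' \<and> (\<forall>t. nregion \<eta> t \<le> nregion \<eta>' t)"

definition open_node ::
  "('t, 'l, 'v, 'f, 'x, 'd) arf \<Rightarrow> ('t, 'l, 'v, 'x, 'd) node \<Rightarrow> bool" where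
  "open_node F \<eta> \<longleftrightarrow> \<eta> \<in> nodes F \<and> satisfiable (node_fml \<eta>) \<and>
     \<not> (\<exists>\<eta>' \<in> nodes F. \<eta>' \<noteq> \<eta> \<and> covered_by \<eta> \<eta>')"

text \<open>
  Closure under the expansion rules.  The precisions change during a run of the procedure, so
  different edges of one forest may have been computed with different precisions.
\<close>

definition complete ::
  "('t, 'l, 'v, 'f, 'x, 'd) program \<Rightarrow> ('t, 'l, 'v, 'f, 'x, 'd) arf \<Rightarrow> bool" where
  "complete P F \<longleftrightarrow> (\<forall>\<eta>. open_node F \<eta> \<longrightarrow>
     (\<forall>t op l' b S'. status (nsched \<eta>) t = Running \<and>
        (nloc \<eta> t, op, l') \<in> cfg_edges (cfg P t) \<and> concretize P (nsched \<eta>) op b S' \<longrightarrow>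
        (\<exists>\<pi>. precision_ok P \<pi> \<and> succ_node P \<pi> \<eta> t l' b S' \<in> nodes F \<and>
             ART \<eta> op b (succ_node P \<pi> \<eta> t l' b S') \<in> arf_edges F)) \<and>
     (\<forall>S'. no_running (nsched \<eta>) \<and> S' \<in> sched P (nsched \<eta>) \<longrightarrow>
        \<eta>\<lparr>nsched := S'\<rparr> \<in> nodes F \<and> Connector \<eta> (\<eta>\<lparr>nsched := S'\<rparr>) \<in> arf_edges F))"

definition error_node ::
  "('t, 'l, 'v, 'f, 'x, 'd) program \<Rightarrow> ('t, 'l, 'v, 'x, 'd) node \<Rightarrow> bool" where
  "error_node P \<eta> \<longleftrightarrow> satisfiable (node_fml \<eta>) \<and> (\<exists>t. nloc \<eta> t \<in> err_locs (cfg P t))"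

definition safe ::
  "('t, 'l, 'v, 'f, 'x, 'd) program \<Rightarrow> ('t, 'l, 'v, 'f, 'x, 'd) arf \<Rightarrow> bool" where
  "safe P F \<longleftrightarrow> complete P F \<and> \<not> (\<exists>\<eta> \<in> nodes F. error_node P \<eta>)"

section \<open>Paths\<close>

fun arf_path :: "('t, 'l, 'v, 'f, 'x, 'd) arf \<Rightarrow> ('t, 'l, 'v, 'x, 'd) node \<Rightarrow>
    ('t, 'l, 'v, 'f, 'x, 'd) arf_edge list \<Rightarrow> ('t, 'l, 'v, 'x, 'd) node \<Rightarrow> bool" where
  "arf_path F \<eta> [] \<eta>' \<longleftrightarrow> \<eta> \<in> nodes F \<and> \<eta> = \<eta>'"
| "arf_path F \<eta> (\<xi> # \<xi>s) \<eta>' \<longleftrightarrow> \<xi> \<in> arf_edges F \<and> src \<xi> = \<eta> \<and> arf_path F (tgt \<xi>) \<xi>s \<eta>'"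

definition counterexample_path :: "('t, 'l, 'v, 'f, 'x, 'd) program \<Rightarrow>
    ('t, 'l, 'v, 'f, 'x, 'd) arf \<Rightarrow> ('t, 'l, 'v, 'f, 'x, 'd) arf_edge list \<Rightarrow> bool" where
  "counterexample_path P F \<rho> \<longleftrightarrow>
     (\<exists>\<eta> \<in> nodes F. error_node P \<eta> \<and> arf_path F (initial_node P) \<rho> \<eta>)"

fun labels :: "('t, 'l, 'v, 'f, 'x, 'd) arf_edge list \<Rightarrow> 'v basic_op list" where
  "labels [] = []"
| "labels (ART \<eta> op b \<eta>' # \<xi>s) = b # labels \<xi>s"
| "labels (Connector \<eta> \<eta>' # \<xi>s) = labels \<xi>s"

definition feasible :: "('t, 'l, 'v, 'f, 'x, 'd) arf_edge list \<Rightarrow> bool" where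
  "feasible \<rho> \<longleftrightarrow> satisfiable (SP_seq (labels \<rho>) (\<lambda>_. True))"

definition sat_node ::
  "('t, 'l, 'v, 'x, 'd) config \<Rightarrow> ('t, 'l, 'v, 'x, 'd) node \<Rightarrow> bool" where
  "sat_node \<gamma> \<eta> \<longleftrightarrow> (\<forall>t. cloc \<gamma> t = nloc \<eta> t) \<and>
     (\<forall>t. thread_state \<gamma> t \<Turnstile> nregion \<eta> t) \<and> joint_state \<gamma> \<Turnstile> nglobal \<eta> \<and>
     csched \<gamma> = nsched \<eta>"

fun sim_edge :: "('t, 'l, 'v, 'f, 'x, 'd) program \<Rightarrow> ('t, 'l, 'v, 'f, 'x, 'd) arf_edge \<Rightarrow>
    ('t, 'l, 'v, 'x, 'd) config \<Rightarrow> ('t, 'l, 'v, 'x, 'd) config \<Rightarrow> bool" where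
  "sim_edge P (ART \<eta> op b \<eta>') \<gamma> \<gamma>' \<longleftrightarrow>
     sat_node \<gamma> \<eta> \<and> sat_node \<gamma>' \<eta>' \<and> config_step P \<gamma> (Some op) \<gamma>'"
| "sim_edge P (Connector \<eta> \<eta>') \<gamma> \<gamma>' \<longleftrightarrow>
     sat_node \<gamma> \<eta> \<and> sat_node \<gamma>' \<eta>' \<and> config_step P \<gamma> None \<gamma>'"

fun sim_path :: "('t, 'l, 'v, 'f, 'x, 'd) program \<Rightarrow> ('t, 'l, 'v, 'f, 'x, 'd) arf_edge list \<Rightarrow>
    ('t, 'l, 'v, 'x, 'd) config \<Rightarrow> ('t, 'l, 'v, 'x, 'd) config \<Rightarrow> bool" where
  "sim_path P [] \<gamma> \<gamma>' \<longleftrightarrow> \<gamma> = \<gamma>'"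
| "sim_path P (\<xi> # \<xi>s) \<gamma> \<gamma>' \<longleftrightarrow> (\<exists>\<gamma>''. sim_edge P \<xi> \<gamma> \<gamma>'' \<and> sim_path P \<xi>s \<gamma>'' \<gamma>')"

section \<open>The ESST procedure\<close>

definition initial_arf ::
  "('t, 'l, 'v, 'f, 'x, 'd) program \<Rightarrow> ('t, 'l, 'v, 'f, 'x, 'd) arf" where
  "initial_arf P = \<lparr>nodes = {initial_node P}, arf_edges = {}\<rparr>"

definition sub_arf :: "('t, 'l, 'v, 'f, 'x, 'd) program \<Rightarrow>
    ('t, 'l, 'v, 'f, 'x, 'd) arf \<Rightarrow> ('t, 'l, 'v, 'f, 'x, 'd) arf \<Rightarrow> bool" where
  "sub_arf P F' F \<longleftrightarrow> initial_node P \<in> nodes F' \<and>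
     nodes F' \<subseteq> nodes F \<and> arf_edges F' \<subseteq> arf_edges F \<and>
     (\<forall>\<xi> \<in> arf_edges F'. src \<xi> \<in> nodes F' \<and> tgt \<xi> \<in> nodes F')"

definition extends_precision ::
  "('t, 'l, 'v) precision \<Rightarrow> ('t, 'l, 'v) precision \<Rightarrow> bool" where
  "extends_precision \<pi>' \<pi> \<longleftrightarrow>
     (\<forall>t l. ploc \<pi> t l \<subseteq> ploc \<pi>' t l) \<and> pglobal \<pi> \<subseteq> pglobal \<pi>'"

text \<open>
  One step of the procedure on the current forest and precisions.  The strategy is left open:
  the node to be expanded is arbitrary; an expansion may add all successors at once, one at a
  time, or, after a refinement, only missing ones; a refinement may discover arbitrary
  predicates and remove an arbitrary part of the forest, as long as the spurious path does not
  survive and the initial node does.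
\<close>

inductive esst_step :: "('t, 'l, 'v, 'f, 'x, 'd) program \<Rightarrow>
    ('t, 'l, 'v, 'f, 'x, 'd) arf \<times> ('t, 'l, 'v) precision \<Rightarrow>
    ('t, 'l, 'v, 'f, 'x, 'd) arf \<times> ('t, 'l, 'v) precision \<Rightarrow> bool"
  for P where
  expand:
    "\<lbrakk>open_node F \<eta>; X \<subseteq> expansions P \<pi> \<eta>\<rbrakk>
     \<Longrightarrow> esst_step P (F, \<pi>) (\<lparr>nodes = nodes F \<union> tgt ` X, arf_edges = arf_edges F \<union> X\<rparr>, \<pi>)"
| refine:
    "\<lbrakk>counterexample_path P F \<rho>; \<not> feasible \<rho>;
      precision_ok P \<pi>'; extends_precision \<pi>' \<pi>;
      sub_arf P F' F; \<not> set \<rho> \<subseteq> arf_edges F'\<rbrakk>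
     \<Longrightarrow> esst_step P (F, \<pi>) (F', \<pi>')"

datatype ('t, 'l, 'v, 'f, 'x, 'd) esst_result =
    Counterexample "('t, 'l, 'v, 'f, 'x, 'd) arf_edge list"
  | Safe "('t, 'l, 'v, 'f, 'x, 'd) arf"

text \<open>\<open>esst_returns P r\<close>: some run of the procedure on \<open>P\<close> terminates with the result \<open>r\<close>.\<close>

inductive esst_returns :: "('t, 'l, 'v, 'f, 'x, 'd) program \<Rightarrow>
    ('t, 'l, 'v, 'f, 'x, 'd) esst_result \<Rightarrow> bool"
  for P where
  return_counterexample:
    "\<lbrakk>precision_ok P \<pi>\<^sub>0; (esst_step P)\<^sup>*\<^sup>* (initial_arf P, \<pi>\<^sub>0) (F, \<pi>);
      counterexample_path P F \<rho>; feasible \<rho>\<rbrakk>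
     \<Longrightarrow> esst_returns P (Counterexample \<rho>)"
| return_safe:
    "\<lbrakk>precision_ok P \<pi>\<^sub>0; (esst_step P)\<^sup>*\<^sup>* (initial_arf P, \<pi>\<^sub>0) (F, \<pi>); safe P F\<rbrakk>
     \<Longrightarrow> esst_returns P (Safe F)"

end

theory Submission
  imports Defs
begin

text \<open>
  On the joint valuation \<open>val \<gamma>\<close> of a configuration, a step executing an operation acts exactly like
  the call-free operation \<open>b\<close> it is concretized to, and \<open>SP b \<phi>\<close> is the image of \<open>\<phi>\<close> under \<open>b\<close>.  Hence
  every concrete step from a configuration satisfying a node leads into the abstract successor.

  For a feasible path, a valuation satisfying the strongest post-condition is traced back to a
  valuation of the initial variables, from which the path is replayed.  For a safe forest, the
  nodes sharing their locations and scheduler state are finite in number, since each expansion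
  draws their regions from a finite set of Boolean combinations.  A reachable configuration that
  satisfies some node therefore satisfies one that is maximal under covering; that node is
  satisfiable and uncovered, hence expanded.
\<close>

section \<open>Predicate abstraction\<close>

text \<open>The value of a combination at \<open>\<sigma>\<close> depends only on the set of
  predicates of \<open>\<pi>\<close> that are true at \<open>\<sigma>\<close>, so a combination is
  coded by the family of truth sets on which it holds.\<close>

lemma finite_bool_combs:
  assumes "finite \<pi>"
  shows "finite (bool_combs \<pi>)"
proof (rule finite_subset)
  let ?h = "\<lambda>A \<sigma>. {p \<in> \<pi>. p \<sigma>} \<in> A"
  show "bool_combs \<pi> \<subseteq> ?h ` Pow (Pow \<pi>)"
  proof
    fix \<phi> assume "\<phi> \<in> bool_combs \<pi>"
    then have "\<exists>A. \<phi> = ?h A"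
    proof induction
      case (bc_pred p)
      then have "p = ?h {B. p \<in> B}" by auto
      then show ?case by blast
    next
      case bc_true
      have "(\<lambda>_. True) = ?h UNIV" by simp
      then show ?case by blast
    next
      case (bc_not \<phi>)
      then obtain A where "\<phi> = ?h A" by blast
      then have "(\<lambda>\<sigma>. \<not> \<phi> \<sigma>) = ?h (- A)" by simp
      then show ?case by blast
    next
      case (bc_and \<phi> \<psi>)
      then obtain A B where "\<phi> = ?h A" "\<psi> = ?h B" by blast
      then have "(\<lambda>\<sigma>. \<phi> \<sigma> \<and> \<psi> \<sigma>) = ?h (A \<inter> B)" by simp
      then show ?case by blast
    next
      case (bc_or \<phi> \<psi>)
      then obtain A B where "\<phi> = ?h A" "\<psi> = ?h B" by blast
      then have "(\<lambda>\<sigma>. \<phi> \<sigma> \<or> \<psi> \<sigma>) = ?h (A \<union> B)" by simp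
      then show ?case by blast
    qed
    then obtain A where A: "\<phi> = ?h A" by blast
    \<comment> \<open>Truth sets are always subsets of \<open>\<pi>\<close>; intersecting with
      \<open>Pow \<pi>\<close> leaves only finitely many codes.\<close>
    have "\<phi> = ?h (A \<inter> Pow \<pi>)" unfolding A by auto
    then show "\<phi> \<in> ?h ` Pow (Pow \<pi>)" by blast
  qed
  show "finite (?h ` Pow (Pow \<pi>))" using assms by simp
qed

lemma bool_combs_Inter:
  assumes "finite A" "A \<subseteq> bool_combs \<pi>"
  shows "(\<lambda>\<sigma>. \<forall>\<psi>\<in>A. \<psi> \<sigma>) \<in> bool_combs \<pi>"
  using assms
proof (induction A)
  case empty
  then show ?case by (simp add: bc_true)
next
  case (insert \<psi> A)
  then show ?case using bc_and[of \<psi> \<pi> "\<lambda>\<sigma>. \<forall>\<psi>\<in>A. \<psi> \<sigma>"] by simp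
qed

text \<open>The operator \<open>LEAST\<close> is meaningful here because only finitely many
  combinations lie above \<open>SP b \<phi>\<close>, and their conjunction is again a
  combination.\<close>

lemma SP_abs_strongest:
  assumes "finite \<pi>"
  shows "SP_abs \<pi> b \<phi> \<in> bool_combs \<pi> \<and> SP b \<phi> \<le> SP_abs \<pi> b \<phi>"
proof -
  let ?A = "{\<psi> \<in> bool_combs \<pi>. SP b \<phi> \<le> \<psi>}"
  have "(\<lambda>\<sigma>. \<forall>\<psi>\<in>?A. \<psi> \<sigma>) \<in> bool_combs \<pi>"
    by (rule bool_combs_Inter) (use finite_bool_combs[OF assms] in auto)
  moreover have "SP b \<phi> \<le> (\<lambda>\<sigma>. \<forall>\<psi>\<in>?A. \<psi> \<sigma>)" by (auto simp: le_fun_def)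
  moreover have "(\<lambda>\<sigma>. \<forall>\<psi>\<in>?A. \<psi> \<sigma>) \<le> \<psi>" if "\<psi> \<in> bool_combs \<pi> \<and> SP b \<phi> \<le> \<psi>" for \<psi>
    using that by (auto simp: le_fun_def)
  ultimately have "SP_abs \<pi> b \<phi> = (\<lambda>\<sigma>. \<forall>\<psi>\<in>?A. \<psi> \<sigma>)"
    unfolding SP_abs_def by (intro Least_equality conjI)
  then show ?thesis
    using \<open>(\<lambda>\<sigma>. \<forall>\<psi>\<in>?A. \<psi> \<sigma>) \<in> bool_combs \<pi>\<close> \<open>SP b \<phi> \<le> (\<lambda>\<sigma>. \<forall>\<psi>\<in>?A. \<psi> \<sigma>)\<close> by metis
qed

lemmas SP_abs_bool_combs = SP_abs_strongest[THEN conjunct1]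

lemma SP_abs_upper:
  assumes "finite \<pi>" "SP b \<phi> \<sigma>"
  shows "SP_abs \<pi> b \<phi> \<sigma>"
  using SP_abs_strongest[OF assms(1), of b \<phi>] assms(2) by (auto simp: le_fun_def)

lemma fml_over_bool_combs:
  assumes "\<phi> \<in> bool_combs \<pi>" "\<forall>p\<in>\<pi>. fml_over V p"
  shows "fml_over V \<phi>"
  using assms(1)
proof induction
  case (bc_pred p)
  then show ?case using assms(2) by blast
next
  case (bc_not \<phi>)
  then show ?case unfolding fml_over_def by metis
next
  case (bc_and \<phi> \<psi>)
  then show ?case unfolding fml_over_def by metis
next
  case (bc_or \<phi> \<psi>)
  then show ?case unfolding fml_over_def by metis
qed (simp add: fml_over_def)

lemma fml_over_SP_abs:
  assumes "finite \<pi>" "\<forall>p\<in>\<pi>. fml_over V p"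
  shows "fml_over V (SP_abs \<pi> b \<phi>)"
  using fml_over_bool_combs[OF SP_abs_bool_combs] assms by blast

section \<open>Call-free operations on valuations\<close>

text \<open>The integer argument is the value written by an assignment; assumptions ignore it.\<close>

fun enabled :: "'v basic_op \<Rightarrow> int \<Rightarrow> ('v \<Rightarrow> int) \<Rightarrow> bool" where
  "enabled (Assign x e) v \<sigma> \<longleftrightarrow> v \<in> vals e \<sigma>"
| "enabled (Assume c) v \<sigma> \<longleftrightarrow> True \<in> bvals c \<sigma>"

fun effect :: "'v basic_op \<Rightarrow> int \<Rightarrow> ('v \<Rightarrow> int) \<Rightarrow> 'v \<Rightarrow> int" where
  "effect (Assign x e) v \<sigma> = \<sigma>(x := v)"
| "effect (Assume c) v \<sigma> = \<sigma>"

text \<open>The bound \<open>x'\<close> in the post-condition of an assignment is the overwritten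
  value: restoring it gives the pre-state, and the value now found at \<open>x\<close> is the one
  written.\<close>

lemma SP_iff: "SP b \<phi> \<sigma>' \<longleftrightarrow> (\<exists>\<sigma> v. \<phi> \<sigma> \<and> enabled b v \<sigma> \<and> \<sigma>' = effect b v \<sigma>)"
proof (cases b)
  case (Assign x e)
  show ?thesis
  proof
    assume "SP b \<phi> \<sigma>'"
    then obtain x' where "\<phi> (\<sigma>'(x := x'))" "\<sigma>' x \<in> vals e (\<sigma>'(x := x'))"
      using Assign by auto
    moreover have "\<sigma>' = (\<sigma>'(x := x'))(x := \<sigma>' x)" by simp
    ultimately show "\<exists>\<sigma> v. \<phi> \<sigma> \<and> enabled b v \<sigma> \<and> \<sigma>' = effect b v \<sigma>"
      unfolding Assign enabled.simps effect.simps by blast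
  next
    assume "\<exists>\<sigma> v. \<phi> \<sigma> \<and> enabled b v \<sigma> \<and> \<sigma>' = effect b v \<sigma>"
    then obtain \<sigma> v where "\<phi> \<sigma>" "v \<in> vals e \<sigma>" "\<sigma>' = \<sigma>(x := v)" using Assign by auto
    \<comment> \<open>The witness for \<open>x'\<close> is the value of \<open>x\<close> before the
      assignment.\<close>
    then show "SP b \<phi> \<sigma>'" using Assign by (auto intro!: exI[of _ "\<sigma> x"])
  qed
qed auto

lemma vals_cong: "(\<And>x. x \<in> exp_vars e \<Longrightarrow> \<sigma> x = \<tau> x) \<Longrightarrow> vals e \<sigma> = vals e \<tau>"
  by (induction e) auto

lemma bvals_cong: "(\<And>x. x \<in> bexp_vars c \<Longrightarrow> \<sigma> x = \<tau> x) \<Longrightarrow> bvals c \<sigma> = bvals c \<tau>"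
proof (induction c)
  case (Rel r e1 e2)
  then show ?case using vals_cong[of e1 \<sigma> \<tau>] vals_cong[of e2 \<sigma> \<tau>] by simp
qed auto

lemma enabled_cong:
  assumes "\<And>x. x \<in> basic_vars b \<Longrightarrow> \<sigma> x = \<tau> x"
  shows "enabled b v \<sigma> = enabled b v \<tau>"
proof (cases b)
  case (Assign x e)
  then show ?thesis using assms vals_cong[of e \<sigma> \<tau>] by simp
next
  case (Assume c)
  then show ?thesis using assms bvals_cong[of c \<sigma> \<tau>] by simp
qed

text \<open>Both valuations receive the same \<open>v\<close>, so agreement on \<open>V\<close>
  survives whether or not the assigned variable lies in \<open>V\<close>.\<close>

lemma effect_cong:
  "(\<And>x. x \<in> V \<Longrightarrow> \<sigma> x = \<tau> x) \<Longrightarrow> x \<in> V \<Longrightarrow> effect b v \<sigma> x = effect b v \<tau> x"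
  by (cases b) auto

section \<open>Configurations and their joint valuations\<close>

text \<open>Total, although the joint state is partial: outside the program variables every
  configuration of \<open>P\<close> yields the same unspecified integer
  \<open>the None\<close>.\<close>

definition val :: "('t, 'l, 'v, 'x, 'd) config \<Rightarrow> 'v \<Rightarrow> int" where
  "val \<gamma> = valuation (joint_state \<gamma>)"

lemma map_Union_eq:
  assumes "m \<in> M" "x \<in> dom m" "\<And>m'. m' \<in> M \<Longrightarrow> x \<in> dom m' \<Longrightarrow> m' = m"
  shows "map_Union M x = m x"
proof -
  obtain v where v: "m x = Some v" using assms(2) by blast
  have "(THE v. \<exists>m\<in>M. m x = Some v) = v"
    using assms(1,3) v by (intro the_equality) (blast, metis domI option.inject)
  then show ?thesis using assms(1) v by (auto simp: map_Union_def)
qed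

context
  fixes P :: "('t, 'l, 'v, 'f, 'x, 'd) program"
  assumes P: "threaded_program P"
begin

section \<open>Consequences of the well-formedness of \<open>P\<close>\<close>

lemma lvars_disjoint: "x \<in> lvars P t \<Longrightarrow> x \<in> lvars P u \<Longrightarrow> t = u"
proof -
  have "\<forall>t u. t \<noteq> u \<longrightarrow> lvars P t \<inter> lvars P u = {}" using P by (simp add: threaded_program_def)
  then show "x \<in> lvars P t \<Longrightarrow> x \<in> lvars P u \<Longrightarrow> t = u" by blast
qed

lemma lvars_gvars_disjoint: "x \<in> lvars P t \<Longrightarrow> x \<notin> gvars P"
proof -
  have "\<forall>t. lvars P t \<inter> gvars P = {}" using P by (simp add: threaded_program_def)
  then show "x \<in> lvars P t \<Longrightarrow> x \<notin> gvars P" by blast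
qed

lemma cfg_ok_cfg: "cfg_ok (cfg P t)"
  using P by (simp add: threaded_program_def)

lemma edge_vars:
  "(l, op, l') \<in> cfg_edges (cfg P t) \<Longrightarrow> op_vars op \<subseteq> lvars P t \<union> gvars P"
  using P unfolding threaded_program_def by metis

lemma edge_call_ok: "(l, op, l') \<in> cfg_edges (cfg P t) \<Longrightarrow> call_ok (arity P) op"
  using P unfolding threaded_program_def by metis

lemma edge_locs: "(l, op, l') \<in> cfg_edges (cfg P t) \<Longrightarrow> l' \<in> locs (cfg P t)"
  using cfg_ok_cfg[of t] by (auto simp: cfg_ok_def)

lemma prim_sched_state_ok:
  "length vs = arity P f \<Longrightarrow> sched_state_ok S \<Longrightarrow> sched_state_ok (snd (prim P f vs S))"
  using P by (simp add: threaded_program_def)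

lemma sched_ex1_running:
  "sched_state_ok S \<Longrightarrow> no_running S \<Longrightarrow> S' \<in> sched P S \<Longrightarrow> \<exists>!t. status S' t = Running"
  using P by (simp add: threaded_program_def)

lemma status_init_sched: "status (init_sched P) t = Running \<longleftrightarrow> t = main P"
  using P by (simp add: threaded_program_def)

lemma concretize_vars:
  assumes "concretize P S op b S'"
  shows "basic_vars b \<subseteq> op_vars op"
  using assms by cases auto

lemma concretize_edge_vars:
  "(l, op, l') \<in> cfg_edges (cfg P t) \<Longrightarrow> concretize P S op b S' \<Longrightarrow>
   basic_vars b \<subseteq> lvars P t \<union> gvars P"
  using edge_vars concretize_vars by blast

lemma concretize_sched_state_ok:
  assumes "concretize P S op b S'" "(l, op, l') \<in> cfg_edges (cfg P t)" "sched_state_ok S"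
  shows "sched_state_ok S'"
  using assms(1)
proof cases
  case (conc_call f cs v x)
  then have "length cs = arity P f" using edge_call_ok[OF assms(2)] by simp
  then have "sched_state_ok (snd (prim P f cs S))"
    using prim_sched_state_ok assms(3) by blast
  then show ?thesis using conc_call by simp
qed (use assms in simp)

lemma joint_state_local:
  assumes "is_config P \<gamma>" "x \<in> lvars P t"
  shows "joint_state \<gamma> x = clocal \<gamma> t x"
  unfolding joint_state_def
proof (rule map_Union_eq)
  show "x \<in> dom (clocal \<gamma> t)" using assms unfolding is_config_def by simp
next
  fix m' assume "m' \<in> insert (cglobal \<gamma>) (range (clocal \<gamma>))" "x \<in> dom m'"
  moreover have "x \<notin> dom (cglobal \<gamma>)" "x \<in> dom (clocal \<gamma> u) \<Longrightarrow> u = t" for u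
    using assms lvars_gvars_disjoint lvars_disjoint unfolding is_config_def by blast+
  ultimately show "m' = clocal \<gamma> t" by blast
qed simp

lemma joint_state_global:
  assumes "is_config P \<gamma>" "x \<in> gvars P"
  shows "joint_state \<gamma> x = cglobal \<gamma> x"
  unfolding joint_state_def
proof (rule map_Union_eq)
  show "x \<in> dom (cglobal \<gamma>)" using assms unfolding is_config_def by simp
next
  fix m' assume "m' \<in> insert (cglobal \<gamma>) (range (clocal \<gamma>))" "x \<in> dom m'"
  moreover have "x \<notin> dom (clocal \<gamma> u)" for u
    using assms lvars_gvars_disjoint unfolding is_config_def by blast
  ultimately show "m' = cglobal \<gamma>" by blast
qed simp

lemma joint_state_None:
  assumes "is_config P \<gamma>" "x \<notin> (\<Union>t. lvars P t) \<union> gvars P"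
  shows "joint_state \<gamma> x = None"
  using assms unfolding joint_state_def map_Union_def is_config_def by auto

text \<open>This allows evaluation in a thread state to be replaced by evaluation in the joint
  valuation. The case split follows \<open>++\<close>, which prefers the global map.\<close>

lemma thread_state_eq_joint_state:
  assumes "is_config P \<gamma>" "x \<in> lvars P t \<union> gvars P"
  shows "thread_state \<gamma> t x = joint_state \<gamma> x"
proof (cases "x \<in> gvars P")
  case True
  then have "x \<in> dom (cglobal \<gamma>)" using assms unfolding is_config_def by simp
  then show ?thesis
    using joint_state_global[OF assms(1) True] by (simp add: thread_state_def map_add_dom_app_simps)
next
  case False
  then have "x \<notin> dom (cglobal \<gamma>)" using assms unfolding is_config_def by simp
  then show ?thesis
    using joint_state_local[OF assms(1)] assms(2) False
    by (simp add: thread_state_def map_add_dom_app_simps)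
qed

lemma thread_state_eq_val:
  assumes "is_config P \<gamma>" "x \<in> lvars P t \<union> gvars P"
  shows "valuation (thread_state \<gamma> t) x = val \<gamma> x"
  using thread_state_eq_joint_state[OF assms] by (simp add: val_def valuation_def)

text \<open>All choices of a step are resolved by the arguments, so the successor is a function of
  them. A call is treated as the assignment of its returned constant; the scheduler state is always
  overwritten, so calls and basic operations share one form.\<close>

fun run :: "'t \<Rightarrow> 'l \<Rightarrow> 'v basic_op \<Rightarrow> int \<Rightarrow> ('t, 'x, 'd) sched_state \<Rightarrow>
    ('t, 'l, 'v, 'x, 'd) config \<Rightarrow> ('t, 'l, 'v, 'x, 'd) config" where
  "run t l' (Assign x e) v S' \<gamma> = (store P t x v (move t l' \<gamma>))\<lparr>csched := S'\<rparr>"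
| "run t l' (Assume c) v S' \<gamma> = (move t l' \<gamma>)\<lparr>csched := S'\<rparr>"

lemma cloc_run [simp]: "cloc (run t l' b v S' \<gamma>) = (cloc \<gamma>)(t := l')"
  by (cases b) (auto simp: store_def move_def)

lemma csched_run [simp]: "csched (run t l' b v S' \<gamma>) = S'"
  by (cases b) auto

lemma is_config_run:
  assumes "is_config P \<gamma>" "basic_vars b \<subseteq> lvars P t \<union> gvars P" "l' \<in> locs (cfg P t)"
    "sched_state_ok S'"
  shows "is_config P (run t l' b v S' \<gamma>)"
  using assms by (cases b) (auto simp: is_config_def store_def move_def)

text \<open>Since the variable sets are disjoint, updating one component of a configuration changes
  the joint valuation at exactly the assigned variable.\<close>

lemma val_run:
  assumes "is_config P \<gamma>" "basic_vars b \<subseteq> lvars P t \<union> gvars P" "l' \<in> locs (cfg P t)"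
    "sched_state_ok S'"
  shows "val (run t l' b v S' \<gamma>) = effect b v (val \<gamma>)"
proof
  fix y
  let ?\<gamma>' = "run t l' b v S' \<gamma>"
  note config' = is_config_run[OF assms, of v]
  have [simp]: "cglobal (move t l' \<gamma>) = cglobal \<gamma>" "clocal (move t l' \<gamma>) = clocal \<gamma>"
    by (simp_all add: move_def)
  consider (global) "y \<in> gvars P" | (local) u where "y \<in> lvars P u"
    | (none) "y \<notin> (\<Union>t. lvars P t) \<union> gvars P" by blast
  then show "val ?\<gamma>' y = effect b v (val \<gamma>) y"
  proof cases
    case global
    then show ?thesis
      using joint_state_global[OF assms(1) global] joint_state_global[OF config' global]
      by (cases b) (auto simp: val_def valuation_def store_def)
  next
    case local
    \<comment> \<open>A local variable of another thread is neither global nor local to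
      \<open>t\<close>, hence is not assigned by \<open>b\<close>.\<close>
    have disj: "y \<notin> gvars P" "u \<noteq> t \<Longrightarrow> y \<notin> lvars P t"
      using local lvars_disjoint lvars_gvars_disjoint by blast+
    show ?thesis
      using joint_state_local[OF assms(1) local] joint_state_local[OF config' local] disj assms(2)
      by (cases b) (auto simp: val_def valuation_def store_def)
  next
    case none
    \<comment> \<open>Both valuations give \<open>the None\<close> at \<open>y\<close>, and
      \<open>b\<close> assigns only program variables.\<close>
    then show ?thesis
      using joint_state_None[OF assms(1) none] joint_state_None[OF config' none] assms(2)
      by (cases b) (auto simp: val_def valuation_def)
  qed
qed

section \<open>Concrete steps expressed by \<open>run\<close>\<close>

lemma list_all2_vals_Const: "list_all2 (\<lambda>e v. v \<in> vals e \<sigma>) (map Const cs) vs \<longleftrightarrow> vs = cs"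
  by (simp add: list_all2_map1 list.rel_eq eq_commute)

lemma enabled_thread_state:
  assumes "is_config P \<gamma>" "basic_vars b \<subseteq> lvars P t \<union> gvars P"
  shows "enabled b v (valuation (thread_state \<gamma> t)) \<longleftrightarrow> enabled b v (val \<gamma>)"
  by (intro enabled_cong thread_state_eq_val[OF assms(1)]) (use assms(2) in blast)

text \<open>Basic operations leave the scheduler state alone, whereas \<open>run\<close> always
  writes it; writing back the present one changes nothing.\<close>

lemma run_same_sched:
  "run t l' (Assign x e) v (csched \<gamma>) \<gamma> = store P t x v (move t l' \<gamma>)"
  "run t l' (Assume c) v (csched \<gamma>) \<gamma> = move t l' \<gamma>"
  by (cases \<gamma>; simp add: store_def move_def)+

text \<open>For a call, the constant arguments force the argument values, so the concretized
  operation is determined. For basic operations, enabledness is transferred from the thread state to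
  \<open>val \<gamma>\<close>.\<close>

lemma config_step_SomeE:
  assumes "config_step P \<gamma> (Some op) \<gamma>'"
  obtains t l' b v S' where "is_config P \<gamma>" "status (csched \<gamma>) t = Running"
    "(cloc \<gamma> t, op, l') \<in> cfg_edges (cfg P t)" "concretize P (csched \<gamma>) op b S'"
    "enabled b v (val \<gamma>)" "\<gamma>' = run t l' b v S' \<gamma>"
  using assms
proof cases
  case (step_assume t c l')
  then have edge: "(cloc \<gamma> t, op, l') \<in> cfg_edges (cfg P t)" by simp
  have conc: "concretize P (csched \<gamma>) op (Assume c) (csched \<gamma>)"
    using step_assume(1) by (simp add: conc_basic)
  \<comment> \<open>The \<open>0\<close> is a dummy, as an assumption writes no value.\<close>
  have "enabled (Assume c) 0 (valuation (thread_state \<gamma> t))" using step_assume by simp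
  then have "enabled (Assume c) 0 (val \<gamma>)"
    using enabled_thread_state[OF \<open>is_config P \<gamma>\<close> concretize_edge_vars[OF edge conc]] by blast
  moreover have "\<gamma>' = run t l' (Assume c) 0 (csched \<gamma>) \<gamma>"
    using step_assume(2) by (simp only: run_same_sched)
  ultimately show ?thesis
    using that[OF \<open>is_config P \<gamma>\<close> \<open>status (csched \<gamma>) t = Running\<close> edge conc] by blast
next
  case (step_assign t x e l' v)
  then have edge: "(cloc \<gamma> t, op, l') \<in> cfg_edges (cfg P t)" by simp
  have conc: "concretize P (csched \<gamma>) op (Assign x e) (csched \<gamma>)"
    using step_assign(1) by (simp add: conc_basic)
  have "enabled (Assign x e) v (valuation (thread_state \<gamma> t))" using step_assign by simp
  then have "enabled (Assign x e) v (val \<gamma>)"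
    using enabled_thread_state[OF \<open>is_config P \<gamma>\<close> concretize_edge_vars[OF edge conc]] by blast
  moreover have "\<gamma>' = run t l' (Assign x e) v (csched \<gamma>) \<gamma>"
    using step_assign(2) by (simp only: run_same_sched)
  ultimately show ?thesis
    using that[OF \<open>is_config P \<gamma>\<close> \<open>status (csched \<gamma>) t = Running\<close> edge conc] by blast
next
  case (step_call t x f es l' vs v S')
  then have edge: "(cloc \<gamma> t, op, l') \<in> cfg_edges (cfg P t)" by simp
  have "\<forall>e\<in>set es. \<exists>c. e = Const c" using edge_call_ok[OF edge] step_call(1) by simp
  then obtain cs where es: "es = map Const cs" by (metis ex_map_conv)
  then have "vs = cs"
    using \<open>list_all2 _ es vs\<close> list_all2_vals_Const by metis
  then have conc: "concretize P (csched \<gamma>) op (Assign x (Const v)) S'"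
    using \<open>prim P f vs (csched \<gamma>) = (v, S')\<close> step_call(1) es conc_call by simp
  have "enabled (Assign x (Const v)) v (val \<gamma>)" by simp
  moreover have "\<gamma>' = run t l' (Assign x (Const v)) v S' \<gamma>" using step_call(2) by simp
  ultimately show ?thesis
    using that[OF \<open>is_config P \<gamma>\<close> \<open>status (csched \<gamma>) t = Running\<close> edge conc] by blast
qed

text \<open>Converse of \<open>config_step_SomeE\<close>, used to turn the edges of an abstract path
  into concrete steps.\<close>

lemma config_step_run:
  assumes "is_config P \<gamma>" "status (csched \<gamma>) t = Running"
    "(cloc \<gamma> t, op, l') \<in> cfg_edges (cfg P t)" "concretize P (csched \<gamma>) op b S'"
    "enabled b v (val \<gamma>)"
  shows "config_step P \<gamma> (Some op) (run t l' b v S' \<gamma>)"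
proof -
  have enabled: "enabled b v (valuation (thread_state \<gamma> t))"
    using assms(5) enabled_thread_state[OF assms(1) concretize_edge_vars[OF assms(3,4)]] by blast
  show ?thesis
    using assms(4)
  proof cases
    case conc_basic
    show ?thesis
    proof (cases b)
      case (Assign x e)
      then show ?thesis
        using step_assign[OF assms(1,2)] assms(3) conc_basic enabled
        by (simp del: run.simps add: run_same_sched)
    next
      case (Assume c)
      then show ?thesis
        using step_assume[OF assms(1,2)] assms(3) conc_basic enabled
        by (simp del: run.simps add: run_same_sched)
    qed
  next
    case (conc_call f cs w x)
    then show ?thesis
      using step_call[OF assms(1,2), of x f "map Const cs" l' cs w S'] assms(3) enabled
      by (simp add: list_all2_vals_Const)
  qed
qed

lemma is_config_step_sched:
  assumes "is_config P \<gamma>" "no_running (csched \<gamma>)" "S' \<in> sched P (csched \<gamma>)"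
  shows "is_config P (\<gamma>\<lparr>csched := S'\<rparr>)"
proof -
  have "\<exists>!t. status S' t = Running"
    using assms by (intro sched_ex1_running[of "csched \<gamma>"]) (auto simp: is_config_def)
  then have "sched_state_ok S'" unfolding sched_state_ok_def by blast
  then show ?thesis using assms(1) by (simp add: is_config_def)
qed

lemma is_config_run_edge:
  assumes "is_config P \<gamma>" "(cloc \<gamma> t, op, l') \<in> cfg_edges (cfg P t)"
    "concretize P (csched \<gamma>) op b S'"
  shows "is_config P (run t l' b v S' \<gamma>)" "val (run t l' b v S' \<gamma>) = effect b v (val \<gamma>)"
proof -
  have "sched_state_ok (csched \<gamma>)" using assms(1) by (simp add: is_config_def)
  note * = concretize_edge_vars[OF assms(2,3)] edge_locs[OF assms(2)]
    concretize_sched_state_ok[OF assms(3,2) this]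
  show "is_config P (run t l' b v S' \<gamma>)" "val (run t l' b v S' \<gamma>) = effect b v (val \<gamma>)"
    using is_config_run[OF assms(1) *] val_run[OF assms(1) *] by auto
qed

lemma val_csched_update [simp]: "val (\<gamma>\<lparr>csched := S'\<rparr>) = val \<gamma>"
  by (simp add: val_def joint_state_def)

section \<open>Abstract successors\<close>

text \<open>Thread regions are evaluated in thread states; restricting their variables allows
  evaluation at \<open>val \<gamma>\<close> instead. The global region is evaluated there by
  definition.\<close>

definition regions_ok :: "('t, 'l, 'v, 'x, 'd) node \<Rightarrow> bool" where
  "regions_ok \<eta> \<longleftrightarrow> (\<forall>t. fml_over (lvars P t \<union> gvars P) (nregion \<eta> t))"

lemma sat_node_iff:
  assumes "is_config P \<gamma>" "regions_ok \<eta>"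
  shows "sat_node \<gamma> \<eta> \<longleftrightarrow> cloc \<gamma> = nloc \<eta> \<and> csched \<gamma> = nsched \<eta> \<and> node_fml \<eta> (val \<gamma>)"
proof -
  have "nregion \<eta> t (valuation (thread_state \<gamma> t)) = nregion \<eta> t (val \<gamma>)" for t
    using assms(2) thread_state_eq_val[OF assms(1)] unfolding regions_ok_def fml_over_def by blast
  then show ?thesis
    by (auto simp: sat_node_def holds_def node_fml_def val_def fun_eq_iff)
qed

lemma regions_ok_initial_node: "regions_ok (initial_node P)"
  by (simp add: regions_ok_def initial_node_def fml_over_def)

lemma regions_ok_succ_node:
  assumes "precision_ok P \<pi>" "regions_ok \<eta>"
  shows "regions_ok (succ_node P \<pi> \<eta> t l' b S')"
  using assms unfolding regions_ok_def precision_ok_def succ_node_def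
  by (auto intro!: fml_over_SP_abs)

text \<open>Soundness of the abstract successor: the new valuation lies in the exact post-condition,
  and abstraction only weakens. Each thread region falls under one of three cases: executing thread,
  havocked, or unchanged.\<close>

lemma node_fml_succ_node:
  assumes "precision_ok P \<pi>" "regions_ok \<eta>" "basic_vars b \<subseteq> lvars P t \<union> gvars P"
    "node_fml \<eta> \<sigma>" "enabled b v \<sigma>"
  shows "node_fml (succ_node P \<pi> \<eta> t l' b S') (effect b v \<sigma>)"
proof -
  have finite: "finite (ploc \<pi> u l)" "finite (pglobal \<pi>)" for u l
    using assms(1) unfolding precision_ok_def by auto
  have SP: "SP b \<phi> (effect b v \<sigma>)" if "\<phi> \<sigma>" for \<phi>
    unfolding SP_iff using that assms(5) by blast
  have havoc: "SP (havoc b) \<phi> (effect b v \<sigma>)" if "\<phi> \<sigma>" for \<phi>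
  proof -
    \<comment> \<open>The havocked assignment admits every value, in particular the \<open>v\<close>
      actually written.\<close>
    have "enabled (havoc b) v \<sigma>" "effect (havoc b) v \<sigma> = effect b v \<sigma>" by (cases b; simp)+
    then show ?thesis unfolding SP_iff using that by metis
  qed
  have conj: "fml_conj (nregion \<eta> u) (nglobal \<eta>) \<sigma>" for u
    using assms(4) by (simp add: fml_conj_def node_fml_def)
  have regions: "SP b (fml_conj (nregion \<eta> u) (nglobal \<eta>)) (effect b v \<sigma>)"
    "SP (havoc b) (fml_conj (nregion \<eta> u) (nglobal \<eta>)) (effect b v \<sigma>)" for u
    by (rule SP havoc, rule conj)+
  have unchanged: "nregion \<eta> u (effect b v \<sigma>)" if "u \<noteq> t" "\<not> updates_global (gvars P) b" for u
  proof -
    \<comment> \<open>Without a global update, \<open>b\<close> assigns at most a local variable of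
      \<open>t\<close>, which is invisible to \<open>u\<close>.\<close>
    have "effect b v \<sigma> x = \<sigma> x" if "x \<in> lvars P u \<union> gvars P" for x
      using that \<open>u \<noteq> t\<close> \<open>\<not> updates_global (gvars P) b\<close> assms(3)
      by (cases b) (auto dest: lvars_disjoint)
    moreover have "nregion \<eta> u \<sigma>" using assms(4) by (simp add: node_fml_def)
    ultimately show ?thesis using assms(2) unfolding regions_ok_def fml_over_def by metis
  qed
  show ?thesis
    using SP_abs_upper[OF finite(2) SP[of "nglobal \<eta>"]] assms(4)
      SP_abs_upper[OF finite(1) regions(1)] SP_abs_upper[OF finite(1) regions(2)] unchanged
    by (auto simp: node_fml_def succ_node_def)
qed

lemma sat_node_run:
  assumes "precision_ok P \<pi>" "regions_ok \<eta>" "is_config P \<gamma>" "sat_node \<gamma> \<eta>"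
    "(cloc \<gamma> t, op, l') \<in> cfg_edges (cfg P t)" "concretize P (csched \<gamma>) op b S'"
    "enabled b v (val \<gamma>)"
  shows "sat_node (run t l' b v S' \<gamma>) (succ_node P \<pi> \<eta> t l' b S')"
proof -
  have "node_fml (succ_node P \<pi> \<eta> t l' b S') (effect b v (val \<gamma>))"
    using node_fml_succ_node[OF assms(1,2) concretize_edge_vars[OF assms(5,6)]] assms
    by (simp add: sat_node_iff)
  then show ?thesis
    unfolding sat_node_iff[OF is_config_run_edge(1)[OF assms(3,5,6)]
        regions_ok_succ_node[OF assms(1,2)]]
    using is_config_run_edge(2)[OF assms(3,5,6)] assms(2,3,4)
    by (simp add: sat_node_iff succ_node_def)
qed

lemma sat_node_sched: "sat_node \<gamma> \<eta> \<Longrightarrow> sat_node (\<gamma>\<lparr>csched := S'\<rparr>) (\<eta>\<lparr>nsched := S'\<rparr>)"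
  by (simp add: sat_node_def thread_state_def joint_state_def)

lemma regions_ok_expansion:
  assumes "precision_ok P \<pi>" "regions_ok \<eta>" "\<xi> \<in> expansions P \<pi> \<eta>"
  shows "regions_ok (tgt \<xi>)"
  using assms(3) by cases (use regions_ok_succ_node[OF assms(1,2)] assms(2) in \<open>auto simp: regions_ok_def\<close>)

section \<open>Feasible paths\<close>

text \<open>The precision is chosen per edge because refinements may change it between the creation
  of two edges.\<close>

definition edges_ok :: "('t, 'l, 'v, 'f, 'x, 'd) arf \<Rightarrow> bool" where
  "edges_ok F \<longleftrightarrow> (\<forall>\<xi>\<in>arf_edges F. \<exists>\<pi>. precision_ok P \<pi> \<and> \<xi> \<in> expansions P \<pi> (src \<xi>))"

text \<open>Node membership is checked only at the end of a path. The prefix ends in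
  \<open>src \<xi>\<close>, so that node is inserted to make the equivalence unconditional.\<close>

lemma arf_path_append:
  "arf_path F \<eta> (\<rho> @ [\<xi>]) \<eta>' \<longleftrightarrow>
     (\<xi> \<in> arf_edges F \<and> tgt \<xi> = \<eta>' \<and> \<eta>' \<in> nodes F) \<and>
     arf_path (F\<lparr>nodes := insert (src \<xi>) (nodes F)\<rparr>) \<eta> \<rho> (src \<xi>)"
  by (induction \<rho> arbitrary: \<eta>) auto

lemma labels_append: "labels (\<rho> @ \<rho>') = labels \<rho> @ labels \<rho>'"
  by (induction \<rho> rule: labels.induct) auto

lemma sim_path_append:
  "sim_path P (\<rho> @ [\<xi>]) \<gamma> \<gamma>' \<longleftrightarrow> (\<exists>\<gamma>''. sim_path P \<rho> \<gamma> \<gamma>'' \<and> sim_edge P \<xi> \<gamma>'' \<gamma>')"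
  by (induction \<rho> arbitrary: \<gamma>) auto

text \<open>Initial values of variables are unconstrained, so any valuation can be realized on the
  program variables.\<close>

lemma ex_initial_config:
  "\<exists>\<gamma>. initial_config P \<gamma> \<and> (\<forall>x\<in>(\<Union>t. lvars P t) \<union> gvars P. val \<gamma> x = \<sigma> x)"
proof -
  define \<gamma> :: "('t, 'l, 'v, 'x, 'd) config" where
    "\<gamma> = \<lparr>cloc = (\<lambda>t. entry (cfg P t)), clocal = (\<lambda>t. (Some \<circ> \<sigma>) |` lvars P t),
       cglobal = (Some \<circ> \<sigma>) |` gvars P, csched = init_sched P\<rparr>"
  have "sched_state_ok (init_sched P)"
    by (simp add: sched_state_ok_def status_init_sched)
  moreover have "entry (cfg P t) \<in> locs (cfg P t)" for t
    using cfg_ok_cfg by (simp add: cfg_ok_def)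
  ultimately have config: "is_config P \<gamma>" by (auto simp: is_config_def \<gamma>_def)
  have "val \<gamma> x = \<sigma> x" if "x \<in> lvars P t" for x t
    using joint_state_local[OF config that] that by (simp add: val_def valuation_def \<gamma>_def)
  moreover have "val \<gamma> x = \<sigma> x" if "x \<in> gvars P" for x
    using joint_state_global[OF config that] that by (simp add: val_def valuation_def \<gamma>_def)
  ultimately show ?thesis
    using config by (intro exI[of _ \<gamma>]) (auto simp: initial_config_def \<gamma>_def)
qed

text \<open>Induction on the last edge, because its post-condition is the outermost one. Prescribing
  the final values \<open>\<sigma>\<close> makes the induction work: the hypothesis is applied to a
  preimage of \<open>\<sigma>\<close> under the last operation. \<open>F\<close> varies because
  splitting off an edge enlarges its node set.\<close>

lemma replay_path:
  assumes "edges_ok F" "arf_path F (initial_node P) \<rho> \<eta>" "SP_seq (labels \<rho>) (\<lambda>_. True) \<sigma>"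
  shows "\<exists>\<gamma> \<gamma>'. initial_config P \<gamma> \<and> is_config P \<gamma>' \<and> sim_path P \<rho> \<gamma> \<gamma>' \<and> sat_node \<gamma>' \<eta> \<and>
    regions_ok \<eta> \<and> (\<forall>x\<in>(\<Union>t. lvars P t) \<union> gvars P. val \<gamma>' x = \<sigma> x)"
  using assms
proof (induction \<rho> arbitrary: F \<eta> \<sigma> rule: rev_induct)
  case Nil
  obtain \<gamma> where \<gamma>: "initial_config P \<gamma>" "\<forall>x\<in>(\<Union>t. lvars P t) \<union> gvars P. val \<gamma> x = \<sigma> x"
    using ex_initial_config by blast
  then have "is_config P \<gamma>" "sat_node \<gamma> (initial_node P)"
    by (auto simp: initial_config_def sat_node_def initial_node_def holds_def)
  then show ?case using \<gamma> Nil regions_ok_initial_node by auto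
next
  case (snoc \<xi> \<rho>)
  let ?F = "F\<lparr>nodes := insert (src \<xi>) (nodes F)\<rparr>"
  let ?V = "(\<Union>t. lvars P t) \<union> gvars P"
  have \<xi>: "\<xi> \<in> arf_edges F" "tgt \<xi> = \<eta>" and path: "arf_path ?F (initial_node P) \<rho> (src \<xi>)"
    using snoc.prems(2) unfolding arf_path_append by auto
  have F: "edges_ok ?F" using snoc.prems(1) by (simp add: edges_ok_def)
  obtain \<pi> where \<pi>: "precision_ok P \<pi>" and exp: "\<xi> \<in> expansions P \<pi> (src \<xi>)"
    using snoc.prems(1) \<xi>(1) unfolding edges_ok_def by blast
  from exp show ?case
  proof cases
    case (expand_op t op l' b S')
    obtain \<sigma>\<^sub>1 v where \<sigma>\<^sub>1: "SP_seq (labels \<rho>) (\<lambda>_. True) \<sigma>\<^sub>1"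
      and v: "enabled b v \<sigma>\<^sub>1" "\<sigma> = effect b v \<sigma>\<^sub>1"
    proof -
      have "SP b (SP_seq (labels \<rho>) (\<lambda>_. True)) \<sigma>"
        using snoc.prems(3) expand_op(1) by (metis SP_seq_def labels_append labels.simps(1,2)
            fold_append fold_simps comp_apply)
      then show ?thesis unfolding SP_iff using that by blast
    qed
    obtain \<gamma> \<gamma>\<^sub>1 where IH: "initial_config P \<gamma>" "is_config P \<gamma>\<^sub>1" "sim_path P \<rho> \<gamma> \<gamma>\<^sub>1"
      "sat_node \<gamma>\<^sub>1 (src \<xi>)" "regions_ok (src \<xi>)" "\<forall>x\<in>?V. val \<gamma>\<^sub>1 x = \<sigma>\<^sub>1 x"
      using snoc.IH[OF F path \<sigma>\<^sub>1] by blast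
    have step: "status (csched \<gamma>\<^sub>1) t = Running" "(cloc \<gamma>\<^sub>1 t, op, l') \<in> cfg_edges (cfg P t)"
      "concretize P (csched \<gamma>\<^sub>1) op b S'"
      using IH(4) expand_op unfolding sat_node_def by auto
    \<comment> \<open>The two valuations agree only on program variables, which suffices as
      \<open>b\<close> mentions no others.\<close>
    have "val \<gamma>\<^sub>1 x = \<sigma>\<^sub>1 x" if "x \<in> basic_vars b" for x
      using that IH(6) concretize_edge_vars[OF step(2,3)] by blast
    then have enabled: "enabled b v (val \<gamma>\<^sub>1)" using v(1) enabled_cong by blast
    let ?\<gamma>' = "run t l' b v S' \<gamma>\<^sub>1"
    have \<eta>: "\<eta> = succ_node P \<pi> (src \<xi>) t l' b S'"
      using arg_cong[OF expand_op(1), of tgt] \<xi>(2) by simp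
    have sat: "sat_node ?\<gamma>' \<eta>"
      using sat_node_run[OF \<pi> IH(5,2,4) step(2,3) enabled] \<eta> by simp
    then have "sim_edge P \<xi> \<gamma>\<^sub>1 ?\<gamma>'"
      using config_step_run[OF IH(2) step enabled] IH(4) \<eta> by (subst expand_op(1)) simp
    moreover have "\<forall>x\<in>?V. val ?\<gamma>' x = \<sigma> x"
      unfolding is_config_run_edge(2)[OF IH(2) step(2,3)] v(2)
      using IH(6) effect_cong[of ?V "val \<gamma>\<^sub>1" \<sigma>\<^sub>1] by blast
    moreover have "is_config P ?\<gamma>'" using is_config_run_edge(1)[OF IH(2) step(2,3)] .
    moreover have "regions_ok \<eta>" using regions_ok_expansion[OF \<pi> IH(5) exp] \<xi>(2) by simp
    ultimately show ?thesis using IH(1,3) sat unfolding sim_path_append by blast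
  next
    case (expand_sched S')
    \<comment> \<open>A connector contributes no label, so the hypothesis applies with the same
      \<open>\<sigma>\<close>.\<close>
    have "labels (\<rho> @ [\<xi>]) = labels \<rho>"
      using expand_sched(1) by (metis labels_append labels.simps(1,3) append_Nil2)
    then obtain \<gamma> \<gamma>\<^sub>1 where IH: "initial_config P \<gamma>" "is_config P \<gamma>\<^sub>1" "sim_path P \<rho> \<gamma> \<gamma>\<^sub>1"
      "sat_node \<gamma>\<^sub>1 (src \<xi>)" "regions_ok (src \<xi>)" "\<forall>x\<in>?V. val \<gamma>\<^sub>1 x = \<sigma> x"
      using snoc.IH[OF F path] snoc.prems(3) by metis
    let ?\<gamma>' = "\<gamma>\<^sub>1\<lparr>csched := S'\<rparr>"
    have \<eta>: "\<eta> = (src \<xi>)\<lparr>nsched := S'\<rparr>" using arg_cong[OF expand_sched(1), of tgt] \<xi>(2) by simp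
    have step: "no_running (csched \<gamma>\<^sub>1)" "S' \<in> sched P (csched \<gamma>\<^sub>1)"
      using IH(4) expand_sched unfolding sat_node_def by auto
    have config: "is_config P ?\<gamma>'" using is_config_step_sched[OF IH(2) step] .
    have ok: "regions_ok \<eta>" using regions_ok_expansion[OF \<pi> IH(5) exp] \<xi>(2) by simp
    have sat: "sat_node ?\<gamma>' \<eta>" unfolding \<eta> using sat_node_sched[OF IH(4)] .
    then have "sim_edge P \<xi> \<gamma>\<^sub>1 ?\<gamma>'"
      using step_sched[OF IH(2) step] IH(4) \<eta> by (subst expand_sched(1)) auto
    then show ?thesis
      using IH(1,3,6) config ok sat unfolding sim_path_append by (metis val_csched_update)
  qed
qed

section \<open>Safe forests\<close>

text \<open>
  A single expansion may produce infinitely many nodes, as schedulers may branch infinitely;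
  only the nodes that can cover each other are finite in number.
\<close>

definition finitely_covered :: "('t, 'l, 'v, 'f, 'x, 'd) arf \<Rightarrow> bool" where
  "finitely_covered F \<longleftrightarrow> (\<forall>l S. finite {\<eta> \<in> nodes F. nloc \<eta> = l \<and> nsched \<eta> = S})"

text \<open>Invariant of a run: \<open>edges_ok\<close> feeds the replay of paths, the other
  conjuncts the argument for safe forests.\<close>

definition arf_ok :: "('t, 'l, 'v, 'f, 'x, 'd) arf \<Rightarrow> bool" where
  "arf_ok F \<longleftrightarrow> initial_node P \<in> nodes F \<and> (\<forall>\<eta>\<in>nodes F. regions_ok \<eta>) \<and>
     edges_ok F \<and> finitely_covered F"

text \<open>Fixing the target locations \<open>l\<close> fixes the precision used for each thread,
  and there are finitely many threads, so finitely many tuples of regions remain.\<close>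

lemma finite_expansion_targets:
  assumes "finite (UNIV :: 't set)" "precision_ok P \<pi>"
  shows "finite {\<eta>' \<in> tgt ` expansions P \<pi> \<eta>. nloc \<eta>' = l \<and> nsched \<eta>' = S}"
proof -
  \<comment> \<open>The old regions are inserted for threads left unchanged by an operation and for
    connectors.\<close>
  define R where "R = (\<Union>j. insert (nregion \<eta> j) (bool_combs (ploc \<pi> j (l j))))"
  define G where "G = insert (nglobal \<eta>) (bool_combs (pglobal \<pi>))"
  let ?R = "{r :: 't \<Rightarrow> 'v fml. \<forall>j. r j \<in> R}"
  let ?mk = "\<lambda>(r, g). \<lparr>nloc = l, nregion = r, nglobal = g, nsched = S\<rparr>"
  have finite: "finite (ploc \<pi> u l)" "finite (pglobal \<pi>)" for u l
    using assms(2) unfolding precision_ok_def by auto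
  have "finite R" using assms(1) finite finite_bool_combs by (auto simp: R_def)
  then have "finite ?R" using finite_set_of_finite_funs[OF assms(1), of R] by simp
  moreover have "finite G" using finite finite_bool_combs by (auto simp: G_def)
  ultimately have "finite (?mk ` (?R \<times> G))" by blast
  moreover have "{\<eta>' \<in> tgt ` expansions P \<pi> \<eta>. nloc \<eta>' = l \<and> nsched \<eta>' = S} \<subseteq>
      ?mk ` (?R \<times> G)"
  proof
    fix \<eta>' assume "\<eta>' \<in> {\<eta>' \<in> tgt ` expansions P \<pi> \<eta>. nloc \<eta>' = l \<and> nsched \<eta>' = S}"
    then obtain \<xi> where "\<xi> \<in> expansions P \<pi> \<eta>" and l: "l = nloc (tgt \<xi>)"
      and S: "S = nsched (tgt \<xi>)" and \<eta>': "\<eta>' = tgt \<xi>" by blast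
    then have "nregion (tgt \<xi>) \<in> ?R \<and> nglobal (tgt \<xi>) \<in> G"
    proof cases
      case (expand_op t op l' b S')
      then show ?thesis
        using l SP_abs_bool_combs[OF finite(1)] SP_abs_bool_combs[OF finite(2)]
        by (auto simp: R_def G_def succ_node_def)
    next
      case (expand_sched S')
      then show ?thesis by (auto simp: R_def G_def)
    qed
    then show "\<eta>' \<in> ?mk ` (?R \<times> G)"
      unfolding \<eta>' l S by (intro image_eqI[of _ _ "(nregion (tgt \<xi>), nglobal (tgt \<xi>))"]) auto
  qed
  ultimately show ?thesis by (rule finite_subset[rotated])
qed

lemma esst_step_arf_ok:
  assumes "finite (UNIV :: 't set)" "esst_step P (F, \<pi>) (F', \<pi>')" "arf_ok F" "precision_ok P \<pi>"
  shows "arf_ok F' \<and> precision_ok P \<pi>'"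
  using assms(2)
proof cases
  case (expand \<eta> X)
  have \<eta>: "\<eta> \<in> nodes F" "regions_ok \<eta>"
    using expand assms(3) unfolding open_node_def arf_ok_def by auto
  have "src \<xi> = \<eta>" if "\<xi> \<in> X" for \<xi>
    using that expand by (auto elim!: expansions.cases dest!: subsetD)
  then have "edges_ok F'"
    using expand assms(3,4) unfolding arf_ok_def edges_ok_def by fastforce
  moreover have "\<forall>\<eta>\<in>nodes F'. regions_ok \<eta>"
    using expand assms(3) regions_ok_expansion[OF assms(4) \<eta>(2)] unfolding arf_ok_def by auto
  moreover have "finitely_covered F'"
    unfolding finitely_covered_def
  proof (intro allI)
    fix l S
    have "finite {\<eta> \<in> nodes F. nloc \<eta> = l \<and> nsched \<eta> = S}"
      using assms(3) unfolding arf_ok_def finitely_covered_def by blast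
    moreover note finite_expansion_targets[OF assms(1,4), of \<eta> l S]
    moreover have "{\<eta> \<in> nodes F'. nloc \<eta> = l \<and> nsched \<eta> = S} \<subseteq>
        {\<eta> \<in> nodes F. nloc \<eta> = l \<and> nsched \<eta> = S} \<union>
        {\<eta>' \<in> tgt ` expansions P \<pi> \<eta>. nloc \<eta>' = l \<and> nsched \<eta>' = S}"
      using expand by auto
    ultimately show "finite {\<eta> \<in> nodes F'. nloc \<eta> = l \<and> nsched \<eta> = S}"
      by (meson finite_UnI finite_subset)
  qed
  ultimately show ?thesis using expand assms(3,4) unfolding arf_ok_def by simp
next
  case (refine \<rho>)
  then have sub: "nodes F' \<subseteq> nodes F" "arf_edges F' \<subseteq> arf_edges F" "initial_node P \<in> nodes F'"
    unfolding sub_arf_def by auto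
  have "finitely_covered F'"
    unfolding finitely_covered_def
  proof (intro allI)
    fix l S
    have "finite {\<eta> \<in> nodes F. nloc \<eta> = l \<and> nsched \<eta> = S}"
      using assms(3) unfolding arf_ok_def finitely_covered_def by blast
    then show "finite {\<eta> \<in> nodes F'. nloc \<eta> = l \<and> nsched \<eta> = S}"
      by (rule rev_finite_subset) (use sub in auto)
  qed
  then show ?thesis using refine sub assms(3) unfolding arf_ok_def edges_ok_def by blast
qed

lemma esst_run_arf_ok:
  assumes "finite (UNIV :: 't set)" "precision_ok P \<pi>\<^sub>0"
    "(esst_step P)\<^sup>*\<^sup>* (initial_arf P, \<pi>\<^sub>0) (F, \<pi>)"
  shows "arf_ok F"
proof -
  have "arf_ok (initial_arf P)"
    using regions_ok_initial_node
    by (simp add: arf_ok_def initial_arf_def edges_ok_def finitely_covered_def)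
  \<comment> \<open>The projections present the invariant as a property of the whole pair, as the
    induction over the run requires.\<close>
  with assms(3) have "arf_ok (fst (F, \<pi>)) \<and> precision_ok P (snd (F, \<pi>))"
  proof (induction rule: rtranclp_induct)
    case base
    then show ?case using assms(2) by simp
  next
    case (step y z)
    then show ?case using esst_step_arf_ok[OF assms(1), of "fst y" "snd y" "fst z" "snd z"] by simp
  qed
  then show ?thesis by simp
qed

lemma covered_by_trans: "covered_by \<eta> \<eta>' \<Longrightarrow> covered_by \<eta>' \<eta>'' \<Longrightarrow> covered_by \<eta> \<eta>''"
  unfolding covered_by_def by (metis order_trans)

text \<open>Formulas are predicates on valuations, so mutual implication is equality, and records
  with equal fields are equal.\<close>

lemma covered_by_antisym: "covered_by \<eta> \<eta>' \<Longrightarrow> covered_by \<eta>' \<eta> \<Longrightarrow> \<eta> = \<eta>'"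
  unfolding covered_by_def by (auto intro!: node.equality ext intro: order_antisym)

lemma sat_node_covered_by: "sat_node \<gamma> \<eta> \<Longrightarrow> covered_by \<eta> \<eta>' \<Longrightarrow> sat_node \<gamma> \<eta>'"
  unfolding sat_node_def covered_by_def holds_def by (auto simp: le_fun_def)

text \<open>Covering preserves satisfaction by \<open>\<gamma>\<close>, so a node maximal among
  those satisfied by \<open>\<gamma>\<close> is covered by no other node at all.\<close>

lemma ex_open_node:
  assumes "arf_ok F" "is_config P \<gamma>" "\<eta> \<in> nodes F" "sat_node \<gamma> \<eta>"
  shows "\<exists>\<eta>'. open_node F \<eta>' \<and> sat_node \<gamma> \<eta>'"
proof -
  let ?N = "{\<eta> \<in> nodes F. sat_node \<gamma> \<eta>}"
  have "?N \<subseteq> {\<eta> \<in> nodes F. nloc \<eta> = cloc \<gamma> \<and> nsched \<eta> = csched \<gamma>}"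
    by (auto simp: sat_node_def)
  then have "finite ?N"
    using assms(1) unfolding arf_ok_def finitely_covered_def by (meson finite_subset)
  moreover have "?N \<noteq> {}" using assms(3,4) by blast
  \<comment> \<open>The maximal element is taken for the strict part of \<open>covered_by\<close>,
    which is transitive and asymmetric.\<close>
  ultimately have "\<exists>\<eta>'\<in>?N. \<forall>\<eta>''\<in>?N. \<eta>'' \<noteq> \<eta>' \<longrightarrow> \<not> (covered_by \<eta>' \<eta>'' \<and> \<eta>' \<noteq> \<eta>'')"
    by (intro Finite_Set.bex_max_element)
      (auto intro!: transp_onI dest: covered_by_trans covered_by_antisym)
  then obtain \<eta>' where \<eta>': "\<eta>' \<in> nodes F" "sat_node \<gamma> \<eta>'"
    and max: "\<And>\<eta>''. \<eta>'' \<in> ?N \<Longrightarrow> \<eta>'' \<noteq> \<eta>' \<Longrightarrow> \<not> covered_by \<eta>' \<eta>''" by blast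
  have "regions_ok \<eta>'" using assms(1) \<eta>'(1) unfolding arf_ok_def by blast
  then have "satisfiable (node_fml \<eta>')"
    \<comment> \<open>The witness of satisfiability is \<open>val \<gamma>\<close>.\<close>
    using \<eta>'(2) sat_node_iff[OF assms(2)] unfolding satisfiable_def by blast
  moreover have "\<not> (\<exists>\<eta>''\<in>nodes F. \<eta>'' \<noteq> \<eta>' \<and> covered_by \<eta>' \<eta>'')"
    using max sat_node_covered_by[OF \<eta>'(2)] by blast
  ultimately show ?thesis using \<eta>' unfolding open_node_def by blast
qed

text \<open>Induction along reachability; \<open>is_config\<close> is carried along because passing
  between \<open>sat_node\<close> and \<open>node_fml\<close> depends on it.\<close>

lemma complete_sat_node:
  assumes "arf_ok F" "complete P F" "reachable P \<gamma>"
  shows "is_config P \<gamma> \<and> (\<exists>\<eta>\<in>nodes F. sat_node \<gamma> \<eta>)"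
  using assms(3)
proof induction
  case (reachable_init \<gamma>)
  then have "sat_node \<gamma> (initial_node P)"
    by (simp add: initial_config_def sat_node_def initial_node_def holds_def)
  then show ?case
    using reachable_init assms(1) unfolding initial_config_def arf_ok_def by blast
next
  case (reachable_step \<gamma> a \<gamma>')
  \<comment> \<open>The node from the induction hypothesis may be covered and hence unexpanded, so
    an open one is taken instead.\<close>
  obtain \<eta> where \<eta>: "open_node F \<eta>" "sat_node \<gamma> \<eta>"
    using ex_open_node[OF assms(1)] reachable_step.IH by blast
  have ok: "regions_ok \<eta>" using assms(1) \<eta>(1) unfolding arf_ok_def open_node_def by blast
  note closed = assms(2)[unfolded complete_def, rule_format, OF \<eta>(1)]
  show ?case
  proof (cases a)
    case (Some op)
    then obtain t l' b v S' where step: "is_config P \<gamma>" "status (csched \<gamma>) t = Running"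
      "(cloc \<gamma> t, op, l') \<in> cfg_edges (cfg P t)" "concretize P (csched \<gamma>) op b S'"
      "enabled b v (val \<gamma>)" and \<gamma>': "\<gamma>' = run t l' b v S' \<gamma>"
      using reachable_step.hyps(2) by (metis config_step_SomeE)
    then obtain \<pi> where "precision_ok P \<pi>" "succ_node P \<pi> \<eta> t l' b S' \<in> nodes F"
      using closed \<eta>(2) unfolding sat_node_def by metis
    then show ?thesis
      using sat_node_run[OF _ ok step(1) \<eta>(2) step(3-5)] is_config_run_edge(1)[OF step(1,3,4)]
      unfolding \<gamma>' by blast
  next
    case None
    with reachable_step.hyps(2) obtain S' where step: "is_config P \<gamma>" "no_running (csched \<gamma>)"
      "S' \<in> sched P (csched \<gamma>)" and \<gamma>': "\<gamma>' = \<gamma>\<lparr>csched := S'\<rparr>"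
      by (auto elim: config_step.cases)
    then have "\<eta>\<lparr>nsched := S'\<rparr> \<in> nodes F"
      using closed \<eta>(2) unfolding sat_node_def by metis
    moreover have "sat_node \<gamma>' (\<eta>\<lparr>nsched := S'\<rparr>)"
      unfolding \<gamma>' using sat_node_sched[OF \<eta>(2)] .
    ultimately show ?thesis using is_config_step_sched[OF step] \<gamma>' by blast
  qed
qed

end

theorem theorem4p7:
  fixes P :: "('t::finite, 'l, 'v, 'f, 'x, 'd) program"
    and r :: "('t, 'l, 'v, 'f, 'x, 'd) esst_result"
  assumes "threaded_program P"
    and "esst_returns P r"
  shows "(\<forall>\<rho>. r = Counterexample \<rho> \<longrightarrow>
            (\<exists>\<gamma> \<gamma>'. initial_config P \<gamma> \<and> error_config P \<gamma>' \<and> sim_path P \<rho> \<gamma> \<gamma>')) \<and>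
         (\<forall>F. r = Safe F \<longrightarrow>
            (\<forall>\<gamma>. reachable P \<gamma> \<longrightarrow> (\<exists>\<eta> \<in> nodes F. sat_node \<gamma> \<eta>)))"
  using assms(2)
proof cases
  case (return_counterexample \<pi>\<^sub>0 F \<pi> \<rho>)
  then have ok: "edges_ok P F"
    using esst_run_arf_ok[OF assms(1) finite_UNIV] by (simp add: arf_ok_def[OF assms(1)])
  obtain \<eta> where \<eta>: "error_node P \<eta>" "arf_path F (initial_node P) \<rho> \<eta>"
    using return_counterexample unfolding counterexample_path_def by blast
  obtain \<sigma> where "SP_seq (labels \<rho>) (\<lambda>_. True) \<sigma>"
    using return_counterexample unfolding feasible_def satisfiable_def by blast
  from replay_path[OF assms(1) ok \<eta>(2) this] obtain \<gamma> \<gamma>' where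
    "initial_config P \<gamma>" "is_config P \<gamma>'" "sim_path P \<rho> \<gamma> \<gamma>'" "sat_node \<gamma>' \<eta>" by blast
  \<comment> \<open>Satisfying a node includes having its locations, so the error location carries
    over to \<open>\<gamma>'\<close>.\<close>
  moreover from this \<eta>(1) have "error_config P \<gamma>'"
    unfolding error_config_def error_node_def sat_node_def by auto
  ultimately show ?thesis using return_counterexample(1) by blast
next
  case (return_safe \<pi>\<^sub>0 F \<pi>)
  then have "arf_ok P F" "complete P F"
    using esst_run_arf_ok[OF assms(1) finite_UNIV] unfolding safe_def by auto
  then show ?thesis using complete_sat_node[OF assms(1)] return_safe(1) by blast
qed

end
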